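(* Let $(X,d,\mu)$ be a quasi-metric-measure space such that $\mu(X)<\infty$ and the measure $\mu$ is locally lower $s$-Ahlfors-regular for some $s\in(0,\infty)$, i.e., there is a constant $b\in(0,\infty)$ such that $\mu(B_d(x,r))\ge br^s$ for all $x\in X$ and $r\in(0,1]$. Then the following statements are valid for all $\alpha,p\in(0,\infty)$ and $q\in(0,\infty]$: (1) If $\alpha p<s$, then for each fixed $\tilde p\in(0,sp/(s-\alpha p))$ the embeddings $M^\alpha_{p,q}(X,d,\mu)\hookrightarrow L^{\tilde p}(X,\mu)$ and $N^\alpha_{p,q}(X,d,\mu)\hookrightarrow L^{\tilde p}(X,\mu)$ are compact. (2) If $\alpha p>s$, then for each fixed $\gamma\in(0,\alpha-s/p)$ the embeddings $M^\alpha_{p,q}(X,d,\mu)\hookrightarrow\mathcal C^\gamma(X,d)$ and $N^\alpha_{p,q}(X,d,\mu)\hookrightarrow\mathcal C^\gamma(X,d)$ are compact. In particular, the embeddings $M^\alpha_{p,q}(X,d,\mu)\hookrightarrow L^{\tilde p}(X,\mu)$ and $N^\alpha_{p,q}(X,d,\mu)\hookrightarrow L^{\tilde p}(X,\mu)$ are compact for all $\tilde p\in(0,\infty)$.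
   Context: A quasi-metric space $(X,d)$ is a set $X$ with at least two elements and a function $d:X\times X\to[0,\infty)$ for which there are constants $C_0,C_1\in(0,\infty)$ such that for all $x,y,z\in X$: $d(x,y)=0$ iff $x=y$; $d(y,x)\le C_0 d(x,y)$; $d(x,y)\le C_1\max\{d(x,z),d(z,y)\}$ (symmetry is not required). Balls are $B_d(x,r):=\{y\in X:d(x,y)<r\}$. The topology $\tau_d$ consists of all $\mathcal O\subseteq X$ such that for each $x\in\mathcal O$ there is $r>0$ with $B_d(x,r)\subseteq\mathcal O$. A quasi-metric-measure space $(X,d,\mu)$ is a quasi-metric space with a nonnegative measure $\mu$ on a $\sigma$-algebra containing the Borel sets of $\tau_d$, such that all $d$-balls are measurable and $\mu(B_d(x,r))\in(0,\infty)$ for all $x\in X$, $r\in(0,\infty)$. Fractional gradients: for $\alpha\in(0,\infty)$ and measurable $u:X\to\mathbb R$, $\mathbb D^\alpha_d(u)$ is the set of sequences $\vec g=\{g_k\}_{k\in\mathbb Z}$ of nonnegative measurable functions on $X$ for which there is a measurable $E$ with $\mu(E)=0$ and $|u(x)-u(y)|\le[d(x,y)]^\alpha(g_k(x)+g_k(y))$ for all $k\in\mathbb Z$ and $x,y\in X\setminus E$ with $2^{-k-1}\le d(x,y)<2^{-k}$. The Hajłasz–Triebel–Lizorkin space $M^\alpha_{p,q}(X,d,\mu)$ is the set of $u\in L^p(X,\mu)$ with finite (quasi-)norm $\|u\|_{L^p(X,\mu)}+\inf_{\vec g\in\mathbb D^\alpha_d(u)}\big\|\,\|\{g_k\}_k\|_{\ell^q(\mathbb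 Z)}\big\|_{L^p(X,\mu)}$; the Hajłasz–Besov space $N^\alpha_{p,q}(X,d,\mu)$ is the set of $u\in L^p(X,\mu)$ with finite (quasi-)norm $\|u\|_{L^p(X,\mu)}+\inf_{\vec g\in\mathbb D^\alpha_d(u)}\big\|\{\|g_k\|_{L^p(X,\mu)}\}_k\big\|_{\ell^q(\mathbb Z)}$. Hölder space: for $\beta\in(0,\infty)$, $\mathcal C^\beta(X,d)$ is the set of bounded $f:X\to\mathbb R$ with finite norm $\sup_{x\in X}|f(x)|+\sup_{x\ne y}\frac{|f(x)-f(y)|}{[d(x,y)]^\beta}$. Functions are identified when equal $\mu$-a.e.; an embedding into $\mathcal C^\beta(X,d)$ means that each $u$ agrees $\mu$-a.e. with a (necessarily unique) element of $\mathcal C^\beta(X,d)$. An embedding is compact if the natural map is well defined and maps bounded sets to totally bounded sets. *)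

theory Defs
  imports "HOL-Analysis.Analysis"
begin

section \<open>Quasi-metric-measure spaces\<close>

definition qball :: "'a set \<Rightarrow> ('a \<Rightarrow> 'a \<Rightarrow> real) \<Rightarrow> 'a \<Rightarrow> real \<Rightarrow> 'a set" where
  "qball X d x r = {y \<in> X. d x y < r}"

definition qopen :: "'a set \<Rightarrow> ('a \<Rightarrow> 'a \<Rightarrow> real) \<Rightarrow> 'a set \<Rightarrow> bool" where
  "qopen X d U \<longleftrightarrow> U \<subseteq> X \<and> (\<forall>x\<in>U. \<exists>r>0. qball X d x r \<subseteq> U)"

locale quasi_metric_space =
  fixes X :: "'a set" and d :: "'a \<Rightarrow> 'a \<Rightarrow> real"
  assumes two_points: "\<exists>x\<in>X. \<exists>y\<in>X. x \<noteq> y"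
    and nonneg: "\<And>x y. x \<in> X \<Longrightarrow> y \<in> X \<Longrightarrow> 0 \<le> d x y"
    and eq_zero_iff: "\<And>x y. x \<in> X \<Longrightarrow> y \<in> X \<Longrightarrow> d x y = 0 \<longleftrightarrow> x = y"
    and quasi_symmetric: "\<exists>C\<^sub>0>0. \<forall>x\<in>X. \<forall>y\<in>X. d y x \<le> C\<^sub>0 * d x y"
    and quasi_triangle:
      "\<exists>C\<^sub>1>0. \<forall>x\<in>X. \<forall>y\<in>X. \<forall>z\<in>X. d x y \<le> C\<^sub>1 * max (d x z) (d z y)"

text \<open>The underlying set is \<^term>\<open>space M\<close>. The sigma-algebra of \<^term>\<open>M\<close> may be strictly larger
  than the Borel one. A ball need not be open, so its measurability is a separate assumption.\<close>

locale quasi_metric_measure_space = quasi_metric_space "space M" d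
  for M :: "'a measure" and d :: "'a \<Rightarrow> 'a \<Rightarrow> real" +
  assumes qopen_sets: "\<And>U. qopen (space M) d U \<Longrightarrow> U \<in> sets M"
    and qball_sets: "\<And>x r. x \<in> space M \<Longrightarrow> 0 < r \<Longrightarrow> qball (space M) d x r \<in> sets M"
    and qball_pos: "\<And>x r. x \<in> space M \<Longrightarrow> 0 < r \<Longrightarrow> 0 < emeasure M (qball (space M) d x r)"
    and qball_finite: "\<And>x r. x \<in> space M \<Longrightarrow> 0 < r \<Longrightarrow> emeasure M (qball (space M) d x r) < \<infinity>"

definition locally_lower_Ahlfors_regular :: "'a measure \<Rightarrow> ('a \<Rightarrow> 'a \<Rightarrow> real) \<Rightarrow> real \<Rightarrow> bool" where
  "locally_lower_Ahlfors_regular M d s \<longleftrightarrow>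
     (\<exists>b::real. 0 < b \<and> (\<forall>x\<in>space M. \<forall>r. 0 < r \<and> r \<le> 1 \<longrightarrow>
        ennreal (b * r powr s) \<le> emeasure M (qball (space M) d x r)))"

section \<open>Lebesgue and sequence (quasi-)norms\<close>

text \<open>All (quasi-)norms take values in \<^typ>\<open>ennreal\<close>. The power below is meant for exponents
  \<^term>\<open>a > 0\<close> only.\<close>

definition epowr :: "ennreal \<Rightarrow> real \<Rightarrow> ennreal" where
  "epowr x a = (if x = \<infinity> then \<infinity> else ennreal (enn2real x powr a))"

definition Lp_qnorm :: "'a measure \<Rightarrow> real \<Rightarrow> ('a \<Rightarrow> ennreal) \<Rightarrow> ennreal" where
  "Lp_qnorm M p f = epowr (\<integral>\<^sup>+x. epowr (f x) p \<partial>M) (1 / p)"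

definition lq_qnorm :: "ennreal \<Rightarrow> (int \<Rightarrow> ennreal) \<Rightarrow> ennreal" where
  "lq_qnorm q a =
     (if q = \<infinity> then (SUP k. a k) else Lp_qnorm (count_space UNIV) (enn2real q) a)"

definition Lp_fun_qnorm :: "'a measure \<Rightarrow> real \<Rightarrow> ('a \<Rightarrow> real) \<Rightarrow> ennreal" where
  "Lp_fun_qnorm M p u = Lp_qnorm M p (\<lambda>x. ennreal \<bar>u x\<bar>)"

text \<open>Function spaces are given by representatives; the identification of functions that agree
  almost everywhere is built into the notion of embedding below.\<close>

definition Lp_fun_space :: "'a measure \<Rightarrow> real \<Rightarrow> ('a \<Rightarrow> real) set" where
  "Lp_fun_space M p = {u \<in> borel_measurable M. Lp_fun_qnorm M p u < \<infinity>}"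

section \<open>Fractional Hajlasz gradients and the associated spaces\<close>

definition frac_gradients ::
  "'a measure \<Rightarrow> ('a \<Rightarrow> 'a \<Rightarrow> real) \<Rightarrow> real \<Rightarrow> ('a \<Rightarrow> real) \<Rightarrow> (int \<Rightarrow> 'a \<Rightarrow> real) set" where
  "frac_gradients M d \<alpha> u =
     {g. (\<forall>k. g k \<in> borel_measurable M \<and> (\<forall>x\<in>space M. 0 \<le> g k x)) \<and>
         (\<exists>E\<in>null_sets M. \<forall>k. \<forall>x\<in>space M - E. \<forall>y\<in>space M - E.
            2 powi (- k - 1) \<le> d x y \<and> d x y < 2 powi (- k) \<longrightarrow>
            \<bar>u x - u y\<bar> \<le> d x y powr \<alpha> * (g k x + g k y))}"

text \<open>The infimum over an empty set of gradients is infinite.\<close>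

definition HTL_qnorm ::
  "'a measure \<Rightarrow> ('a \<Rightarrow> 'a \<Rightarrow> real) \<Rightarrow> real \<Rightarrow> real \<Rightarrow> ennreal \<Rightarrow> ('a \<Rightarrow> real) \<Rightarrow> ennreal" where
  "HTL_qnorm M d \<alpha> p q u = Lp_fun_qnorm M p u +
     (INF g\<in>frac_gradients M d \<alpha> u. Lp_qnorm M p (\<lambda>x. lq_qnorm q (\<lambda>k. ennreal (g k x))))"

definition HTL_space ::
  "'a measure \<Rightarrow> ('a \<Rightarrow> 'a \<Rightarrow> real) \<Rightarrow> real \<Rightarrow> real \<Rightarrow> ennreal \<Rightarrow> ('a \<Rightarrow> real) set" where
  "HTL_space M d \<alpha> p q = {u \<in> Lp_fun_space M p. HTL_qnorm M d \<alpha> p q u < \<infinity>}"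

definition HB_qnorm ::
  "'a measure \<Rightarrow> ('a \<Rightarrow> 'a \<Rightarrow> real) \<Rightarrow> real \<Rightarrow> real \<Rightarrow> ennreal \<Rightarrow> ('a \<Rightarrow> real) \<Rightarrow> ennreal" where
  "HB_qnorm M d \<alpha> p q u = Lp_fun_qnorm M p u +
     (INF g\<in>frac_gradients M d \<alpha> u. lq_qnorm q (\<lambda>k. Lp_fun_qnorm M p (g k)))"

definition HB_space ::
  "'a measure \<Rightarrow> ('a \<Rightarrow> 'a \<Rightarrow> real) \<Rightarrow> real \<Rightarrow> real \<Rightarrow> ennreal \<Rightarrow> ('a \<Rightarrow> real) set" where
  "HB_space M d \<alpha> p q = {u \<in> Lp_fun_space M p. HB_qnorm M d \<alpha> p q u < \<infinity>}"

section \<open>Hoelder spaces\<close>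

definition Hoelder_norm :: "'a set \<Rightarrow> ('a \<Rightarrow> 'a \<Rightarrow> real) \<Rightarrow> real \<Rightarrow> ('a \<Rightarrow> real) \<Rightarrow> ennreal" where
  "Hoelder_norm X d \<beta> f = (SUP x\<in>X. ennreal \<bar>f x\<bar>) +
     (SUP (x, y)\<in>{(x, y). x \<in> X \<and> y \<in> X \<and> x \<noteq> y}. ennreal (\<bar>f x - f y\<bar> / d x y powr \<beta>))"

definition Hoelder_space :: "'a set \<Rightarrow> ('a \<Rightarrow> 'a \<Rightarrow> real) \<Rightarrow> real \<Rightarrow> ('a \<Rightarrow> real) set" where
  "Hoelder_space X d \<beta> = {f. bounded (f ` X) \<and> Hoelder_norm X d \<beta> f < \<infinity>}"

section \<open>Compact embeddings\<close>

definition qnorm_bounded :: "(('a \<Rightarrow> real) \<Rightarrow> ennreal) \<Rightarrow> ('a \<Rightarrow> real) set \<Rightarrow> bool" where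
  "qnorm_bounded N A \<longleftrightarrow> (\<exists>C<\<infinity>. \<forall>u\<in>A. N u \<le> C)"

definition qnorm_totally_bounded :: "(('a \<Rightarrow> real) \<Rightarrow> ennreal) \<Rightarrow> ('a \<Rightarrow> real) set \<Rightarrow> bool" where
  "qnorm_totally_bounded N B \<longleftrightarrow>
     (\<forall>\<epsilon>::real. 0 < \<epsilon> \<longrightarrow> (\<exists>K. finite K \<and> K \<subseteq> B \<and> (\<forall>v\<in>B. \<exists>w\<in>K. N (\<lambda>x. v x - w x) < ennreal \<epsilon>)))"

text \<open>The natural map sends (the class of) \<^term>\<open>u \<in> S\<close> to the element \<^term>\<open>v \<in> T\<close> with
  \<^prop>\<open>AE x in M. u x = v x\<close>. It is well defined if such a \<^term>\<open>v\<close> exists and is unique as an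
  element of the target, i.e. up to functions of vanishing target (quasi-)norm: for Lebesgue spaces
  this is uniqueness almost everywhere, for Hoelder spaces it is uniqueness at every point of
  \<^term>\<open>space M\<close>.\<close>

definition natural_map_well_defined ::
  "'a measure \<Rightarrow> ('a \<Rightarrow> real) set \<Rightarrow> ('a \<Rightarrow> real) set \<Rightarrow> (('a \<Rightarrow> real) \<Rightarrow> ennreal) \<Rightarrow> bool" where
  "natural_map_well_defined M S T NT \<longleftrightarrow>
     (\<forall>u\<in>S. \<exists>v\<in>T. (AE x in M. u x = v x) \<and>
        (\<forall>w\<in>T. (AE x in M. u x = w x) \<longrightarrow> NT (\<lambda>x. v x - w x) = 0))"

definition natural_image ::
  "'a measure \<Rightarrow> ('a \<Rightarrow> real) set \<Rightarrow> ('a \<Rightarrow> real) set \<Rightarrow> ('a \<Rightarrow> real) set" where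
  "natural_image M T A = {v \<in> T. \<exists>u\<in>A. AE x in M. u x = v x}"

definition compact_embedding ::
  "'a measure \<Rightarrow> ('a \<Rightarrow> real) set \<Rightarrow> (('a \<Rightarrow> real) \<Rightarrow> ennreal) \<Rightarrow>
   ('a \<Rightarrow> real) set \<Rightarrow> (('a \<Rightarrow> real) \<Rightarrow> ennreal) \<Rightarrow> bool" where
  "compact_embedding M S NS T NT \<longleftrightarrow>
     natural_map_well_defined M S T NT \<and>
     (\<forall>A\<subseteq>S. qnorm_bounded NS A \<longrightarrow> qnorm_totally_bounded NT (natural_image M T A))"

end

theory Submission
  imports Defs
begin

text \<open>
  All the spaces involved are reduced to one simple class. On a bounded space, a fractional
  gradient of order \<open>\<alpha>\<close> whose entries \<open>g\<^sub>k\<close> are merely bounded in \<open>L\<^sup>p\<close> uniformly in \<open>k\<close> can be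
  summed against a geometric weight at the price of an arbitrarily small loss of smoothness: for
  every \<open>\<beta> < \<alpha>\<close> one obtains a single function \<open>h\<close> with \<open>\<bar>u x - u y\<bar> \<le> d(x,y)\<^sup>\<beta> (h x + h y)\<close> and a bound on
  \<open>\<integral> h\<^sup>p\<close> (\<open>hajlasz_class_of_gradients\<close>). Both the Triebel--Lizorkin and the Besov quasi-norm dominate
  the \<open>L\<^sup>p\<close> quasi-norm of each \<open>g\<^sub>k\<close>, for every \<open>q\<close>. All exponents in the theorem are in open ranges,
  so the loss from \<open>\<alpha>\<close> to \<open>\<beta>\<close> is harmless.

  The improvement in integrability or continuity comes from one chaining estimate
  (\<open>oscillation_chain\<close>). By the Markov inequality and the lower bound on the measure of balls, every
  ball of radius \<open>\<rho> 2\<^sup>-\<^sup>j\<^sup>p\<^sup>/\<^sup>s\<close> about \<open>x\<close> contains a point where \<open>h \<le> 2\<^sup>j \<kappa>\<close>, once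
  \<open>\<rho>\<^sup>s \<kappa>\<^sup>p\<close> is large compared with \<open>\<integral> h\<^sup>p\<close>. Passing
  through these points, from \<open>x\<close> itself out to the ball of radius \<open>\<rho>\<close>, changes \<open>u\<close> by at most a geometric sum
  with ratio \<open>2\<^sup>1\<^sup>-\<^sup>\<beta>\<^sup>p\<^sup>/\<^sup>s\<close>. If \<open>\<beta> p < s\<close>, the last term dominates and \<open>\<bar>u\<bar>\<close> is bounded by a multiple of
  \<open>(1 + h)\<^sup>1\<^sup>-\<^sup>\<beta>\<^sup>p\<^sup>/\<^sup>s\<close>, which is the Sobolev embedding into \<open>L\<^sup>r\<close> with \<open>r = s p / (s - \<beta> p)\<close>
  (\<open>hajlasz_class_higher_integrability\<close>). If \<open>\<beta> p > s\<close>, the sum is bounded independently of the number of steps and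
  \<open>u\<close> is Hoelder continuous with exponent \<open>\<beta> - s / p\<close> off a null set (\<open>hajlasz_class_Hoelder\<close>).

  Compactness rests on the total boundedness of the space, which follows from the finite total measure
  and the lower bound on balls (\<open>finite_net\<close>). A function is coded by its values, rounded to a
  grid, at one point near each point of a finite net; there are finitely many codes, so it
  suffices that functions with equal codes are close. In the Hoelder case this is the argument of
  Arzela and Ascoli combined with interpolation between the exponents \<open>0\<close> and \<open>\<beta> - s / p\<close>. In the
  Lebesgue case the sampling points are taken in a set of almost full measure where the function is
  bounded and Hoelder continuous; equal codes then give closeness in measure, and the bound in
  \<open>L\<^sup>r\<close> for a larger exponent turns it into closeness in the target space.

  The Lebesgue embeddings for \<open>\<alpha> p > s\<close> need no separate argument: as \<open>\<beta>\<close> increases to \<open>s / p\<close>, the exponent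
  \<open>s p / (s - \<beta> p)\<close> tends to infinity.
\<close>

section \<open>Lower Ahlfors-regular spaces of finite measure\<close>

text \<open>The two quasi-metric constants are replaced by their maximum, which may be taken to be at
  least \<open>1\<close>. Fixing \<open>b\<close> and \<open>K\<close> makes the later bounds uniform over all functions of a class.\<close>

locale ahlfors_space = quasi_metric_measure_space M d
  for M :: "'a measure" and d :: "'a \<Rightarrow> 'a \<Rightarrow> real" +
  fixes s b K :: real
  assumes s_pos: "0 < s" and b_pos: "0 < b" and K_ge_1: "1 \<le> K"
    and sym: "\<And>x y. x \<in> space M \<Longrightarrow> y \<in> space M \<Longrightarrow> d y x \<le> K * d x y"
    and tri: "\<And>x y z. x \<in> space M \<Longrightarrow> y \<in> space M \<Longrightarrow> z \<in> space M \<Longrightarrow>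
                d x y \<le> K * max (d x z) (d z y)"
    and finite_total: "emeasure M (space M) < \<infinity>"
    and regular: "\<And>x r. x \<in> space M \<Longrightarrow> 0 < r \<Longrightarrow> r \<le> 1 \<Longrightarrow>
                    ennreal (b * r powr s) \<le> emeasure M (qball (space M) d x r)"
begin

sublocale finite_measure M
  using finite_total by (intro finite_measureI) auto

lemma le_K_mult: "0 \<le> t \<Longrightarrow> t \<le> K * t"
  using K_ge_1 by (simp add: mult_le_cancel_right1)

lemma K_pos: "0 < K"
  using K_ge_1 by simp

lemma dist_pos: "x \<in> space M \<Longrightarrow> y \<in> space M \<Longrightarrow> x \<noteq> y \<Longrightarrow> 0 < d x y"
  using nonneg[of x y] eq_zero_iff[of x y] by force

lemma tri_le:
  assumes "x \<in> space M" "y \<in> space M" "z \<in> space M" "d x z \<le> r" "d z y \<le> r"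
  shows "d x y \<le> K * r"
proof -
  have "d x y \<le> K * max (d x z) (d z y)" using tri assms by blast
  also have "\<dots> \<le> K * r" using assms K_ge_1 by (intro mult_left_mono) auto
  finally show ?thesis .
qed

lemma sym_le:
  assumes "x \<in> space M" "y \<in> space M" "d x y \<le> r"
  shows "d y x \<le> K * r"
  using sym[OF assms(1,2)] mult_left_mono[OF assms(3), of K] K_ge_1 by linarith

lemma dist_le_from_center:
  assumes "x \<in> space M" "y \<in> space M" "z \<in> space M" "d z x \<le> r" "d z y \<le> r"
  shows "d x y \<le> K\<^sup>2 * r"
proof -
  have "0 \<le> r" using nonneg[of z x] assms by linarith
  then have "d z y \<le> K * r" using assms(5) le_K_mult by (meson order_trans)
  then have "d x y \<le> K * (K * r)"
    using tri_le[of x y z] sym_le[of z x r] assms by blast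
  then show ?thesis by (simp add: power2_eq_square mult.assoc)
qed

lemma dist_perturb_le:
  assumes "x \<in> space M" "y \<in> space M" "x' \<in> space M" "y' \<in> space M"
    and "d x x' \<le> r" "d y y' \<le> r" "d x y \<le> r"
  shows "d x' y' \<le> K\<^sup>2 * r"
proof -
  have "0 \<le> r" using nonneg[of x y] assms by linarith
  then have "d x' y' \<le> K * (K * r)"
    using assms by (intro tri_le[of x' y' x] sym_le tri_le[of x y' y]) auto
  then show ?thesis by (simp add: power2_eq_square mult.assoc)
qed

text \<open>Balls of a fixed radius around the points of a separated set are disjoint and have
  measure bounded below, so in a space of finite measure a separated set has boundedly many points. A separated set of maximal
  cardinality is then the required net.\<close>

lemma finite_net:
  assumes "0 < \<delta>"
  obtains F where "finite F" "F \<subseteq> space M" "\<And>x. x \<in> space M \<Longrightarrow> \<exists>y\<in>F. d y x < \<delta>"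
proof -
  \<comment> \<open>Maximality only gives \<open>d x y < t\<close> or \<open>d y x < t\<close>; the factor \<open>K\<close> pays for reversing the order.\<close>
  define t where "t = \<delta> / K"
  have t: "0 < t" using assms K_ge_1 by (simp add: t_def)
  define sep where "sep F \<longleftrightarrow> finite F \<and> F \<subseteq> space M \<and> (\<forall>x\<in>F. \<forall>y\<in>F. x \<noteq> y \<longrightarrow> t \<le> d x y)" for F
  \<comment> \<open>Balls of this radius about two points at distance at least \<open>t\<close> are disjoint, since \<open>K\<^sup>2 * r < t\<close>.\<close>
  define r where "r = min 1 (t / (2 * K\<^sup>2))"
  have r: "0 < r" "r \<le> 1" using t K_pos by (auto simp: r_def)
  have Kr: "K\<^sup>2 * r < t"
  proof -
    have "K\<^sup>2 * r \<le> K\<^sup>2 * (t / (2 * K\<^sup>2))" by (intro mult_left_mono) (auto simp: r_def)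
    also have "\<dots> = t / 2" using K_pos by simp
    finally show ?thesis using t by simp
  qed
  define c where "c = b * r powr s"
  have c: "0 < c" using b_pos r by (simp add: c_def)
  have bound: "card F \<le> nat \<lceil>measure M (space M) / c\<rceil>" if F: "sep F" for F
  proof -
    have disj: "disjoint_family_on (\<lambda>x. qball (space M) d x r) F"
    proof (clarsimp simp: disjoint_family_on_def)
      fix x y assume xy: "x \<in> F" "y \<in> F" "x \<noteq> y"
      have False if z: "z \<in> space M" "d x z < r" "d y z < r" for z
      proof -
        have X: "x \<in> space M" "y \<in> space M" using xy F by (auto simp: sep_def)
        have "d x z \<le> K * r" using z r le_K_mult[of r] by linarith
        moreover have "d z y \<le> K * r" using z X by (intro sym_le) auto
        ultimately have "d x y \<le> K * (K * r)" using X z tri_le by blast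
        then have "d x y < t" using Kr by (simp add: power2_eq_square mult.assoc)
        then show False using xy F by (force simp: sep_def)
      qed
      then show "qball (space M) d x r \<inter> qball (space M) d y r = {}"
        by (auto simp: qball_def)
    qed
    have "real (card F) * c = (\<Sum>x\<in>F. c)" by simp
    also have "\<dots> \<le> (\<Sum>x\<in>F. measure M (qball (space M) d x r))"
    proof (intro sum_mono)
      fix x assume "x \<in> F"
      then have "ennreal c \<le> ennreal (measure M (qball (space M) d x r))"
        using regular[of x r] F r by (auto simp: sep_def c_def emeasure_eq_measure)
      then show "c \<le> measure M (qball (space M) d x r)" by (simp add: ennreal_le_iff)
    qed
    also have "\<dots> = measure M (\<Union>x\<in>F. qball (space M) d x r)"
      using F qball_sets r disj
      by (intro finite_measure_finite_Union[symmetric]) (auto simp: sep_def)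
    also have "\<dots> \<le> measure M (space M)" by (rule bounded_measure)
    finally have "real (card F) \<le> measure M (space M) / c" using c by (simp add: field_simps)
    then show ?thesis by linarith
  qed
  have "sep {}" by (simp add: sep_def)
  then obtain F where F: "sep F" "\<And>G. sep G \<Longrightarrow> card G \<le> card F"
    using ex_has_greatest_nat[of sep "{}" card] bound by (metis le_imp_less_Suc)
  have "\<exists>y\<in>F. d y x < \<delta>" if x: "x \<in> space M" for x
  proof (cases "x \<in> F")
    case True
    then show ?thesis using eq_zero_iff[of x x] x assms by force
  next
    case False
    have "card (insert x F) > card F" using False F(1) by (simp add: sep_def)
    then have "\<not> sep (insert x F)" using F(2) by force
    then obtain y where y: "y \<in> F" "d x y < t \<or> d y x < t" using F(1) x eq_zero_iff[of x x]
      unfolding sep_def by (smt (verit) finite_insert insert_iff insert_subset)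
    have ys: "y \<in> space M" using y F(1) by (auto simp: sep_def)
    have "d y x < K * t"
    proof (cases "d y x < t")
      case True
      then show ?thesis using le_K_mult[of t] t by linarith
    next
      case False
      then have "K * d x y < K * t" using y K_pos by simp
      then show ?thesis using sym[OF x ys] by linarith
    qed
    then show ?thesis using y K_pos by (auto simp: t_def)
  qed
  then show ?thesis using that F(1) by (auto simp: sep_def)
qed

lemma bounded_space: "\<exists>D>0. \<forall>x\<in>space M. \<forall>y\<in>space M. d x y \<le> D"
proof -
  obtain F where F: "finite F" "F \<subseteq> space M" "\<And>x. x \<in> space M \<Longrightarrow> \<exists>y\<in>F. d y x < 1"
    using finite_net[of 1] by auto
  define R where "R = Max (insert 1 ((\<lambda>(x, y). d x y) ` (F \<times> F)))"
  have R1: "1 \<le> R" unfolding R_def using F by (intro Max_ge) auto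
  have R: "d x y \<le> R" if "x \<in> F" "y \<in> F" for x y
    unfolding R_def using that F by (intro Max_ge) auto
  have "d x y \<le> K\<^sup>2 * (K * R)" if xy: "x \<in> space M" "y \<in> space M" for x y
  proof -
    obtain u v where uv: "u \<in> F" "v \<in> F" "d u x < 1" "d v y < 1" using F(3) xy by blast
    then have s: "u \<in> space M" "v \<in> space M" using F by auto
    have "d u y \<le> K * R" using uv s xy R R1 by (intro tri_le[of u y v]) force+
    moreover have "d u x \<le> K * R" using uv R1 le_K_mult[of R] by linarith
    ultimately show ?thesis using dist_le_from_center[of x y u] xy s by blast
  qed
  moreover have "0 < K\<^sup>2 * (K * R)" using K_pos R1 by simp
  ultimately show ?thesis by blast
qed

text \<open>The Markov inequality beats the lower bound on the measure of a ball: a function whose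
  \<open>p\<close>-th power has small integral cannot be large on a whole ball.\<close>

lemma point_below_level:
  assumes x: "x \<in> space M" and r: "0 < r" "r \<le> 1" and E: "E \<in> null_sets M"
    and "0 < \<kappa>" "0 < p"
    and h: "h \<in> borel_measurable M" "(\<integral>\<^sup>+y. ennreal (h y powr p) \<partial>M) \<le> ennreal C"
    and C: "C < b * r powr s * \<kappa> powr p"
  obtains y where "y \<in> space M" "y \<notin> E" "d x y < r" "h y \<le> \<kappa>"
proof (rule ccontr)
  assume no: "\<not> thesis"
  note pick = that
  define B where "B = qball (space M) d x r - E"
  have B: "B \<in> sets M" "emeasure M B = emeasure M (qball (space M) d x r)"
    using qball_sets[OF x r(1)] E by (auto simp: B_def emeasure_Diff_null_set)
  have big: "\<kappa> \<le> h y" if "y \<in> B" for y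
    using that no pick[of y] unfolding B_def qball_def by (force simp: not_le)
  have "ennreal (b * r powr s * \<kappa> powr p) = ennreal (\<kappa> powr p) * ennreal (b * r powr s)"
    by (simp add: mult.commute flip: ennreal_mult')
  also have "\<dots> \<le> ennreal (\<kappa> powr p) * emeasure M B"
    unfolding B(2) using regular[OF x r] by (intro mult_left_mono) auto
  also have "\<dots> = (\<integral>\<^sup>+y. ennreal (\<kappa> powr p) * indicator B y \<partial>M)"
    using B(1) by (simp add: nn_integral_cmult_indicator)
  also have "\<dots> \<le> (\<integral>\<^sup>+y. ennreal (h y powr p) \<partial>M)"
    using big \<open>0 < \<kappa>\<close> \<open>0 < p\<close>
    by (intro nn_integral_mono) (auto intro!: ennreal_leI powr_mono2 split: split_indicator)
  also have "\<dots> \<le> ennreal C" by (rule h)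
  finally have "b * r powr s * \<kappa> powr p \<le> C \<or> b * r powr s * \<kappa> powr p \<le> 0"
    by (auto simp: ennreal_le_iff2)
  moreover have "0 < b * r powr s * \<kappa> powr p" using b_pos r \<open>0 < \<kappa>\<close> by simp
  ultimately show False using C by linarith
qed

end

section \<open>Functions with a Hajlasz majorant\<close>

text \<open>The majorant also dominates the function itself. Thus a single integral
  bound on it controls both parts of the norm, and one point where it is small controls both the
  size and the oscillation.\<close>

definition hajlasz_majorant ::
  "'a measure \<Rightarrow> ('a \<Rightarrow> 'a \<Rightarrow> real) \<Rightarrow> real \<Rightarrow> ('a \<Rightarrow> real) \<Rightarrow> 'a set \<Rightarrow> ('a \<Rightarrow> real) \<Rightarrow> bool" where
  "hajlasz_majorant M d \<beta> u E h \<longleftrightarrow>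
     E \<in> null_sets M \<and> h \<in> borel_measurable M \<and>
     (\<forall>x\<in>space M - E. \<bar>u x\<bar> \<le> h x) \<and>
     (\<forall>x\<in>space M - E. \<forall>y\<in>space M - E. \<bar>u x - u y\<bar> \<le> d x y powr \<beta> * (h x + h y))"

definition hajlasz_class ::
  "'a measure \<Rightarrow> ('a \<Rightarrow> 'a \<Rightarrow> real) \<Rightarrow> real \<Rightarrow> real \<Rightarrow> real \<Rightarrow> ('a \<Rightarrow> real) set" where
  "hajlasz_class M d \<beta> p C =
     {u. \<exists>E h. hajlasz_majorant M d \<beta> u E h \<and> (\<integral>\<^sup>+x. ennreal (h x powr p) \<partial>M) \<le> ennreal C}"

text \<open>The exceptional set absorbs any change on a null set, so bounds on the class pass to every
  representative in the image of an embedding.\<close>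

lemma hajlasz_class_cong_AE:
  assumes "u \<in> hajlasz_class M d \<beta> p C" "AE x in M. u x = v x"
  shows "v \<in> hajlasz_class M d \<beta> p C"
proof -
  obtain E h where h: "hajlasz_majorant M d \<beta> u E h" "(\<integral>\<^sup>+x. ennreal (h x powr p) \<partial>M) \<le> ennreal C"
    using assms by (auto simp: hajlasz_class_def)
  obtain N where N: "N \<in> null_sets M" "\<And>x. x \<in> space M \<Longrightarrow> x \<notin> N \<Longrightarrow> v x = u x"
    using assms(2) by (auto elim!: AE_E3)
  have "hajlasz_majorant M d \<beta> v (E \<union> N) h"
    using h(1) N unfolding hajlasz_majorant_def by (simp add: null_sets.Un)
  then show ?thesis using h(2) by (auto simp: hajlasz_class_def)
qed

lemma exists_dyadic_bound:
  fixes a \<kappa> :: real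
  assumes "0 < \<kappa>"
  obtains J where "a \<le> \<kappa> * 2 ^ J" "2 ^ J \<le> max 1 (2 * a / \<kappa>)"
proof -
  define J where "J = (LEAST j. a \<le> \<kappa> * 2 ^ j)"
  obtain n where "a / \<kappa> < 2 ^ n" using real_arch_pow[of 2 "a / \<kappa>"] by auto
  then have "a \<le> \<kappa> * 2 ^ n" using assms by (simp add: field_simps)
  then have J: "a \<le> \<kappa> * 2 ^ J" unfolding J_def by (rule LeastI)
  have "2 ^ J \<le> max 1 (2 * a / \<kappa>)"
  proof (cases J)
    case (Suc j)
    have "\<not> a \<le> \<kappa> * 2 ^ j" using Suc not_less_Least[of j "\<lambda>j. a \<le> \<kappa> * 2 ^ j"] by (simp add: J_def)
    then show ?thesis using Suc assms by (simp add: field_simps le_max_iff_disj)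
  qed simp
  then show ?thesis using J that by blast
qed

context ahlfors_space
begin

text \<open>The radii \<open>\<rho> 2\<^sup>-\<^sup>j\<^sup>p\<^sup>/\<^sup>s\<close> and the levels \<open>2\<^sup>j \<kappa>\<close> are matched so that the product
  \<open>radius\<^sup>s * level\<^sup>p\<close> stays constant; hence the same inequality between \<open>C\<close> and this product yields a
  good point at every scale. All balls are centred at \<open>x\<close> rather than at the preceding point of the
  chain, so the quasi-triangle constant enters each step once and does not accumulate. Once the level
  \<open>2\<^sup>J \<kappa>\<close> exceeds \<open>h x\<close>, the point \<open>x\<close> itself is good and the chain can start there.\<close>

lemma oscillation_chain:
  assumes maj: "hajlasz_majorant M d \<beta> u E h"
    and int: "(\<integral>\<^sup>+x. ennreal (h x powr p) \<partial>M) \<le> ennreal C"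
    and pos: "0 < p" "0 < \<beta>"
    and x: "x \<in> space M" "x \<notin> E"
  shows "\<lbrakk>0 < \<rho>; \<rho> \<le> 1; 0 < \<kappa>; C < b * \<rho> powr s * \<kappa> powr p; h x \<le> \<kappa> * 2 ^ J\<rbrakk> \<Longrightarrow>
    \<exists>y\<in>space M - E. d x y < \<rho> \<and> h y \<le> \<kappa> \<and>
      \<bar>u x - u y\<bar> \<le> 3 * (K\<^sup>2) powr \<beta> * \<rho> powr \<beta> * \<kappa> * (\<Sum>j<J. (2 powr (1 - \<beta> * p / s)) ^ j)"
proof (induction J arbitrary: \<rho> \<kappa>)
  case 0
  then show ?case using x eq_zero_iff[of x x] by (intro bexI[of _ x]) auto
next
  case (Suc J)
  define \<theta> where "\<theta> = 2 powr (1 - \<beta> * p / s)"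
  define c where "c = 3 * (K\<^sup>2) powr \<beta>"
  define r where "r = \<rho> * 2 powr (- p / s)"
  have "2 powr (- p / s) \<le> (1::real)" using pos s_pos powr_mono[of "- p / s" 0 2] by simp
  then have r: "0 < r" "r \<le> \<rho>"
    using Suc.prems by (auto simp: r_def mult_le_cancel_left1)
  have "r powr s = \<rho> powr s * 2 powr (- p)"
    using Suc.prems s_pos by (simp add: r_def powr_mult powr_powr)
  then have "b * r powr s * (2 * \<kappa>) powr p = b * \<rho> powr s * \<kappa> powr p"
    using Suc.prems by (simp add: powr_mult powr_minus)
  then have "\<exists>y\<in>space M - E. d x y < r \<and> h y \<le> 2 * \<kappa> \<and>
      \<bar>u x - u y\<bar> \<le> c * r powr \<beta> * (2 * \<kappa>) * (\<Sum>j<J. \<theta> ^ j)"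
    unfolding c_def \<theta>_def using Suc.prems r by (intro Suc.IH) (auto simp: mult_ac)
  then obtain y where y: "y \<in> space M" "y \<notin> E" "d x y < r" "h y \<le> 2 * \<kappa>"
      "\<bar>u x - u y\<bar> \<le> c * r powr \<beta> * (2 * \<kappa>) * (\<Sum>j<J. \<theta> ^ j)" by blast
  obtain z where z: "z \<in> space M" "z \<notin> E" "d x z < \<rho>" "h z \<le> \<kappa>"
    using point_below_level[of x \<rho> E \<kappa> p h C] x Suc.prems pos int maj
    unfolding hajlasz_majorant_def by blast
  have "d y z \<le> K\<^sup>2 * \<rho>" using x y z r by (intro dist_le_from_center[of y z x]) auto
  then have "d y z powr \<beta> \<le> (K\<^sup>2) powr \<beta> * \<rho> powr \<beta>"
    using nonneg[of y z] y z pos Suc.prems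
    by (metis less_imp_le powr_mono2 powr_mult zero_le_power2)
  moreover have "\<bar>u y - u z\<bar> \<le> d y z powr \<beta> * (h y + h z)"
    using maj y z unfolding hajlasz_majorant_def by blast
  moreover have "d y z powr \<beta> * (h y + h z) \<le> d y z powr \<beta> * (3 * \<kappa>)"
    using y z by (intro mult_left_mono) auto
  moreover have "d y z powr \<beta> * (3 * \<kappa>) \<le> ((K\<^sup>2) powr \<beta> * \<rho> powr \<beta>) * (3 * \<kappa>)"
    using calculation(1) Suc.prems by (intro mult_right_mono) auto
  ultimately have "\<bar>u y - u z\<bar> \<le> c * \<rho> powr \<beta> * \<kappa>"
    by (simp add: c_def mult_ac)
  moreover have "c * r powr \<beta> * (2 * \<kappa>) * (\<Sum>j<J. \<theta> ^ j) = c * \<rho> powr \<beta> * \<kappa> * (\<theta> * (\<Sum>j<J. \<theta> ^ j))"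
  proof -
    have "\<theta> = 2 powr (- p / s * \<beta>) * 2"
      unfolding \<theta>_def by (simp add: powr_diff powr_minus field_simps)
    then show ?thesis using Suc.prems by (simp add: r_def powr_mult powr_powr)
  qed
  ultimately have "\<bar>u x - u z\<bar> \<le> c * \<rho> powr \<beta> * \<kappa> * (1 + \<theta> * (\<Sum>j<J. \<theta> ^ j))"
    using y(5) unfolding distrib_left mult_1_right by linarith
  also have "1 + \<theta> * (\<Sum>j<J. \<theta> ^ j) = (\<Sum>j<Suc J. \<theta> ^ j)"
    unfolding sum.lessThan_Suc_shift by (simp add: sum_distrib_left)
  finally show ?case using z unfolding c_def \<theta>_def by auto
qed

text \<open>The chain for \<open>\<rho> = 1\<close> has ratio \<open>\<theta> > 1\<close>, so its sum is comparable with \<open>\<theta>\<^sup>J\<close>. As \<open>2\<^sup>J\<close> is at most a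
  multiple of \<open>h x\<close> (or \<open>1\<close>), the sum is at most a multiple of \<open>(max 1 (h x))\<^sup>\<sigma>\<close> with
  \<open>\<sigma> = 1 - \<beta> p / s\<close>, and the exponent \<open>s p / (s - \<beta> p)\<close> equals \<open>p / \<sigma>\<close>.\<close>

lemma hajlasz_class_higher_integrability:
  assumes pos: "0 < p" "0 < \<beta>" "0 \<le> C" and sub: "\<beta> * p < s"
  obtains C' where "0 \<le> C'"
    "\<And>u. u \<in> hajlasz_class M d \<beta> p C \<Longrightarrow>
       (\<integral>\<^sup>+x. ennreal (\<bar>u x\<bar> powr (s * p / (s - \<beta> * p))) \<partial>M) \<le> ennreal C'"
proof -
  define \<sigma> where "\<sigma> = 1 - \<beta> * p / s"
  have \<sigma>: "0 < \<sigma>" using sub s_pos by (simp add: \<sigma>_def field_simps)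
  define p' where "p' = s * p / (s - \<beta> * p)"
  have p': "0 < p'" "\<sigma> * p' = p" using pos sub s_pos by (auto simp: p'_def \<sigma>_def field_simps)
  \<comment> \<open>Any level with \<open>C < b * \<kappa>\<^sup>p\<close> is admissible for balls of radius \<open>1\<close>.\<close>
  define \<kappa> where "\<kappa> = ((C + 1) / b) powr (1 / p)"
  have \<kappa>: "0 < \<kappa>" "C < b * 1 powr s * \<kappa> powr p"
    using b_pos pos by (auto simp: \<kappa>_def powr_powr)
  define \<theta> where "\<theta> = 2 powr \<sigma>"
  have \<theta>: "1 < \<theta>" using \<sigma> by (simp add: \<theta>_def)
  define c where "c = 3 * (K\<^sup>2) powr \<beta>"
  define A where "A = \<kappa> * (1 + c / (\<theta> - 1))"
  have c: "0 \<le> c" by (simp add: c_def)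
  have A: "0 \<le> A" using \<kappa> \<theta> c by (simp add: A_def)
  define B where "B = (2 / \<kappa>) powr p"
  have B: "0 \<le> B" by (simp add: B_def)
  define C' where "C' = A powr p' * (measure M (space M) + B * C)"
  have "(\<integral>\<^sup>+x. ennreal (\<bar>u x\<bar> powr p') \<partial>M) \<le> ennreal C'" if u: "u \<in> hajlasz_class M d \<beta> p C" for u
  proof -
    obtain E h where maj: "hajlasz_majorant M d \<beta> u E h"
      and int: "(\<integral>\<^sup>+x. ennreal (h x powr p) \<partial>M) \<le> ennreal C"
      using u by (auto simp: hajlasz_class_def)
    have hm[measurable]: "h \<in> borel_measurable M" using maj by (simp add: hajlasz_majorant_def)
    have le_h: "\<bar>u x\<bar> \<le> h x" if "x \<in> space M" "x \<notin> E" for x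
      using maj that unfolding hajlasz_majorant_def by blast
    have *: "\<bar>u x\<bar> powr p' \<le> A powr p' * (1 + B * h x powr p)" if x: "x \<in> space M" "x \<notin> E" for x
    proof -
      have h0: "0 \<le> h x" using le_h[OF x] by linarith
      define m where "m = max 1 (2 * h x / \<kappa>)"
      have m: "1 \<le> m" by (simp add: m_def)
      obtain J where J: "h x \<le> \<kappa> * 2 ^ J" "2 ^ J \<le> m"
        using exists_dyadic_bound[OF \<kappa>(1), of "h x"] by (auto simp: m_def)
      obtain y where y: "y \<in> space M" "y \<notin> E" "h y \<le> \<kappa>" "\<bar>u x - u y\<bar> \<le> c * \<kappa> * (\<Sum>j<J. \<theta> ^ j)"
        using oscillation_chain[OF maj int pos(1,2) x _ _ \<kappa> J(1)] unfolding c_def \<theta>_def \<sigma>_def by auto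
      have "\<theta> ^ J = (2 ^ J) powr \<sigma>"
        unfolding \<theta>_def by (simp add: powr_powr mult.commute flip: powr_realpow)
      also have "\<dots> \<le> m powr \<sigma>" using J \<sigma> by (intro powr_mono2) auto
      finally have "(\<Sum>j<J. \<theta> ^ j) \<le> m powr \<sigma> / (\<theta> - 1)"
        using \<theta> by (simp add: geometric_sum divide_right_mono)
      then have "c * \<kappa> * (\<Sum>j<J. \<theta> ^ j) \<le> c * \<kappa> * (m powr \<sigma> / (\<theta> - 1))"
        using c \<kappa> by (intro mult_left_mono) auto
      moreover have "\<bar>u y\<bar> \<le> \<kappa>" using le_h[OF y(1,2)] y(3) by linarith
      moreover have "\<kappa> \<le> \<kappa> * m powr \<sigma>" using m \<kappa> \<sigma> by (simp add: ge_one_powr_ge_zero)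
      ultimately have "\<bar>u x\<bar> \<le> \<kappa> * m powr \<sigma> + c * \<kappa> * (m powr \<sigma> / (\<theta> - 1))"
        using y(4) by linarith
      also have "\<dots> = A * m powr \<sigma>" by (simp add: A_def algebra_simps)
      finally have "\<bar>u x\<bar> powr p' \<le> (A * m powr \<sigma>) powr p'" using p' by (intro powr_mono2) auto
      also have "\<dots> = A powr p' * m powr p" using A p' by (simp add: powr_mult powr_powr)
      also have "\<dots> \<le> A powr p' * (1 + B * h x powr p)"
      proof (intro mult_left_mono)
        show "m powr p \<le> 1 + B * h x powr p"
          using h0 \<kappa> pos by (auto simp: m_def max_def B_def powr_mult powr_divide)
      qed simp
      finally show ?thesis .
    qed
    have "(\<integral>\<^sup>+x. ennreal (\<bar>u x\<bar> powr p') \<partial>M) \<le> (\<integral>\<^sup>+x. ennreal (A powr p' * (1 + B * h x powr p)) \<partial>M)"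
      using maj * by (intro nn_integral_mono_AE) (auto simp: hajlasz_majorant_def intro!: AE_I' ennreal_leI)
    also have "\<dots> = (\<integral>\<^sup>+x. ennreal (A powr p') * (1 + ennreal B * ennreal (h x powr p)) \<partial>M)"
      using B by (simp add: ennreal_mult' ennreal_plus)
    also have "\<dots> = ennreal (A powr p') * (emeasure M (space M) + ennreal B * (\<integral>\<^sup>+x. ennreal (h x powr p) \<partial>M))"
      by (simp add: nn_integral_cmult nn_integral_add)
    also have "\<dots> \<le> ennreal (A powr p') * (ennreal (measure M (space M)) + ennreal B * ennreal C)"
      using int by (intro mult_left_mono add_mono) (auto simp: emeasure_eq_measure)
    also have "\<dots> = ennreal C'"
      using B pos by (simp add: C'_def ennreal_mult' ennreal_plus)
    finally show ?thesis .
  qed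
  moreover have "0 \<le> C'" using B pos by (simp add: C'_def)
  ultimately show ?thesis using that unfolding p'_def by blast
qed

text \<open>The chain now has ratio \<open>\<theta> < 1\<close> and is bounded uniformly in its length. The level admissible for
  the radius \<open>\<rho>\<close> is \<open>\<kappa> \<rho>\<^sup>-\<^sup>s\<^sup>/\<^sup>p\<close>, so moving from \<open>x\<close> to a good point within distance \<open>\<rho>\<close> costs a multiple of
  \<open>\<rho>\<^sup>\<beta>\<^sup>-\<^sup>s\<^sup>/\<^sup>p\<close>. For two points at distance \<open>\<rho> \<le> 1\<close> one moves from each to a good point and compares the
  values there; for \<open>\<rho> > 1\<close> the sup bound suffices.\<close>

lemma hajlasz_class_Hoelder:
  assumes pos: "0 < p" "0 < \<beta>" "0 < C" and super: "s < \<beta> * p"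
  obtains L where "0 \<le> L"
    "\<And>u. u \<in> hajlasz_class M d \<beta> p C \<Longrightarrow> \<exists>E\<in>null_sets M.
       (\<forall>x\<in>space M - E. \<bar>u x\<bar> \<le> L) \<and>
       (\<forall>x\<in>space M - E. \<forall>y\<in>space M - E. \<bar>u x - u y\<bar> \<le> L * d x y powr (\<beta> - s / p))"
proof -
  define \<gamma> where "\<gamma> = \<beta> - s / p"
  have \<gamma>: "0 < \<gamma>" using super pos by (simp add: \<gamma>_def field_simps)
  define \<theta> where "\<theta> = 2 powr (1 - \<beta> * p / s)"
  have "1 - \<beta> * p / s < 0" using super s_pos by (simp add: field_simps)
  then have \<theta>: "0 < \<theta>" "\<theta> < 1" using powr_less_mono[of "1 - \<beta> * p / s" 0 2] by (simp_all add: \<theta>_def)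
  define \<kappa> where "\<kappa> = (2 * C / b) powr (1 / p)"
  have \<kappa>: "0 < \<kappa>" using pos b_pos by (simp add: \<kappa>_def)
  define c where "c = 3 * (K\<^sup>2) powr \<beta>"
  define A where "A = c * \<kappa> / (1 - \<theta>)"
  have c: "0 \<le> c" by (simp add: c_def)
  have A: "0 \<le> A" using c \<kappa> \<theta> by (simp add: A_def)
  define L where "L = 2 * (A + \<kappa>) + 2 * A + (K\<^sup>2) powr \<beta> * (2 * \<kappa>)"
  have "\<exists>E\<in>null_sets M. (\<forall>x\<in>space M - E. \<bar>u x\<bar> \<le> L) \<and>
       (\<forall>x\<in>space M - E. \<forall>y\<in>space M - E. \<bar>u x - u y\<bar> \<le> L * d x y powr \<gamma>)"
    if u: "u \<in> hajlasz_class M d \<beta> p C" for u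
  proof -
    obtain E h where maj: "hajlasz_majorant M d \<beta> u E h"
      and int: "(\<integral>\<^sup>+x. ennreal (h x powr p) \<partial>M) \<le> ennreal C"
      using u by (auto simp: hajlasz_class_def)
    have near: "\<exists>y\<in>space M - E. d x y < \<rho> \<and> h y \<le> \<kappa> * \<rho> powr (- s / p) \<and> \<bar>u x - u y\<bar> \<le> A * \<rho> powr \<gamma>"
      if x: "x \<in> space M" "x \<notin> E" and \<rho>: "0 < \<rho>" "\<rho> \<le> 1" for x \<rho>
    proof -
      define l where "l = \<kappa> * \<rho> powr (- s / p)"
      have l: "0 < l" using \<kappa> \<rho> by (simp add: l_def)
      have "l powr p = 2 * C / b * \<rho> powr (- s)"
        using b_pos pos by (simp add: l_def \<kappa>_def powr_mult powr_powr)
      then have "b * \<rho> powr s * l powr p = 2 * C"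
        using \<rho> b_pos by (simp add: powr_minus)
      then have C: "C < b * \<rho> powr s * l powr p" using pos by simp
      obtain J where J: "h x \<le> l * 2 ^ J" using exists_dyadic_bound[OF l] by blast
      obtain y where y: "y \<in> space M - E" "d x y < \<rho>" "h y \<le> l"
          "\<bar>u x - u y\<bar> \<le> c * \<rho> powr \<beta> * l * (\<Sum>j<J. \<theta> ^ j)"
        using oscillation_chain[OF maj int pos(1,2) x \<rho> l C J] unfolding c_def \<theta>_def by auto
      have "(\<Sum>j<J. \<theta> ^ j) \<le> 1 / (1 - \<theta>)"
        using \<theta> by (simp add: sum_gp_strict divide_right_mono)
      then have "c * \<rho> powr \<beta> * l * (\<Sum>j<J. \<theta> ^ j) \<le> c * \<rho> powr \<beta> * l * (1 / (1 - \<theta>))"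
        using c l by (intro mult_left_mono) auto
      also have "\<dots> = A * \<rho> powr \<gamma>"
        using \<rho> by (simp add: A_def l_def \<gamma>_def powr_diff powr_minus field_simps)
      finally show ?thesis using y unfolding l_def by force
    qed
    have bd: "\<bar>u x\<bar> \<le> A + \<kappa>" if "x \<in> space M - E" for x
    proof -
      have "\<exists>y\<in>space M - E. d x y < 1 \<and> h y \<le> \<kappa> \<and> \<bar>u x - u y\<bar> \<le> A"
        using near[of x 1] that by simp
      then obtain y where y: "y \<in> space M - E" "h y \<le> \<kappa>" "\<bar>u x - u y\<bar> \<le> A" by blast
      moreover have "\<bar>u y\<bar> \<le> h y" using maj y unfolding hajlasz_majorant_def by blast
      ultimately show ?thesis by linarith
    qed
    have "\<bar>u x - u y\<bar> \<le> L * d x y powr \<gamma>" if xy: "x \<in> space M - E" "y \<in> space M - E" for x y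
    proof (cases "x = y")
      case False
      define \<rho> where "\<rho> = d x y"
      have \<rho>: "0 < \<rho>" using dist_pos xy False by (simp add: \<rho>_def)
      show ?thesis
      proof (cases "\<rho> \<le> 1")
        case True
        obtain x' where x': "x' \<in> space M - E" "d x x' < \<rho>" "h x' \<le> \<kappa> * \<rho> powr (- s / p)"
            "\<bar>u x - u x'\<bar> \<le> A * \<rho> powr \<gamma>"
          using near[of x \<rho>] \<rho> True xy by auto
        obtain y' where y': "y' \<in> space M - E" "d y y' < \<rho>" "h y' \<le> \<kappa> * \<rho> powr (- s / p)"
            "\<bar>u y - u y'\<bar> \<le> A * \<rho> powr \<gamma>"
          using near[of y \<rho>] \<rho> True xy by auto
        have "d x' y' \<le> K\<^sup>2 * \<rho>"
          using x' y' xy by (intro dist_perturb_le[of x y]) (auto simp: \<rho>_def)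
        then have "d x' y' powr \<beta> \<le> (K\<^sup>2) powr \<beta> * \<rho> powr \<beta>"
          using nonneg[of x' y'] x' y' pos \<rho>
          by (metis DiffD1 less_imp_le powr_mono2 powr_mult zero_le_power2)
        moreover have "\<bar>u x' - u y'\<bar> \<le> d x' y' powr \<beta> * (h x' + h y')"
          using maj x' y' unfolding hajlasz_majorant_def by blast
        moreover have "d x' y' powr \<beta> * (h x' + h y') \<le> d x' y' powr \<beta> * (2 * (\<kappa> * \<rho> powr (- s / p)))"
          using x' y' by (intro mult_left_mono) auto
        moreover have "d x' y' powr \<beta> * (2 * (\<kappa> * \<rho> powr (- s / p))) \<le>
            ((K\<^sup>2) powr \<beta> * \<rho> powr \<beta>) * (2 * (\<kappa> * \<rho> powr (- s / p)))"
          using calculation(1) \<kappa> by (intro mult_right_mono) auto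
        moreover have "((K\<^sup>2) powr \<beta> * \<rho> powr \<beta>) * (2 * (\<kappa> * \<rho> powr (- s / p))) =
            (K\<^sup>2) powr \<beta> * (2 * \<kappa>) * \<rho> powr \<gamma>"
          using \<rho> by (simp add: \<gamma>_def powr_diff powr_minus field_simps)
        ultimately have "\<bar>u x' - u y'\<bar> \<le> (K\<^sup>2) powr \<beta> * (2 * \<kappa>) * \<rho> powr \<gamma>" by linarith
        then have "\<bar>u x - u y\<bar> \<le> (2 * A + (K\<^sup>2) powr \<beta> * (2 * \<kappa>)) * \<rho> powr \<gamma>"
          using x'(4) y'(4) by (simp add: distrib_right)
        also have "\<dots> \<le> L * \<rho> powr \<gamma>" using A \<kappa> by (intro mult_right_mono) (auto simp: L_def)
        finally show ?thesis by (simp add: \<rho>_def)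
      next
        case False
        have "\<bar>u x - u y\<bar> \<le> 2 * (A + \<kappa>)" 
          unfolding mult_2 by (rule order_trans[OF abs_triangle_ineq4 add_mono[OF bd[OF xy(1)] bd[OF xy(2)]]])
        also have "\<dots> \<le> L * 1" using A \<kappa> by (simp add: L_def)
        also have "\<dots> \<le> L * \<rho> powr \<gamma>"
          using False \<gamma> A \<kappa> by (intro mult_left_mono) (auto simp: L_def ge_one_powr_ge_zero)
        finally show ?thesis by (simp add: \<rho>_def)
      qed
    qed (use A \<kappa> in \<open>simp add: L_def\<close>)
    moreover have "\<bar>u x\<bar> \<le> L" if "x \<in> space M - E" for x
    proof -
      have "A + \<kappa> \<le> L" using A \<kappa> by (simp add: L_def)
      then show ?thesis using bd[OF that] by linarith
    qed
    ultimately show ?thesis using maj unfolding hajlasz_majorant_def by blast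
  qed
  moreover have "0 \<le> L" using A \<kappa> by (simp add: L_def)
  ultimately show ?thesis using that unfolding \<gamma>_def by blast
qed

end

section \<open>Quasi-norms and fractional gradients\<close>

lemma epowr_ennreal: "0 \<le> a \<Longrightarrow> epowr (ennreal a) r = ennreal (a powr r)"
  by (simp add: epowr_def)

lemma epowr_mono:
  assumes "x \<le> y" "0 \<le> r"
  shows "epowr x r \<le> epowr y r"
  using assms by (cases x; cases y) (auto simp: epowr_def top_unique intro!: ennreal_leI powr_mono2)

lemma epowr_epowr_inverse: "0 < r \<Longrightarrow> epowr (epowr x r) (1 / r) = x"
  by (cases x) (auto simp: epowr_def powr_powr)

lemma epowr_less_top_iff [simp]: "epowr x r < \<infinity> \<longleftrightarrow> x < \<infinity>"
  by (auto simp: epowr_def less_top)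

lemma le_epowr_of_epowr_inverse_le:
  assumes "epowr x (1 / p) \<le> c" "0 < p"
  shows "x \<le> epowr c p"
  using epowr_mono[OF assms(1), of p] epowr_epowr_inverse[of "1 / p" x] assms(2) by simp

lemma Lp_fun_qnorm_eq: "Lp_fun_qnorm M p u = epowr (\<integral>\<^sup>+x. ennreal (\<bar>u x\<bar> powr p) \<partial>M) (1 / p)"
  by (simp add: Lp_fun_qnorm_def Lp_qnorm_def epowr_ennreal)

lemma Lp_fun_qnorm_less:
  assumes "(\<integral>\<^sup>+x. ennreal (\<bar>u x\<bar> powr p) \<partial>M) < ennreal (e powr p)" "0 < p" "0 < e"
  shows "Lp_fun_qnorm M p u < ennreal e"
proof (rule ccontr)
  assume "\<not> ?thesis"
  then have "epowr (ennreal e) p \<le> epowr (Lp_fun_qnorm M p u) p"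
    using assms(2) by (intro epowr_mono) (auto simp: not_less)
  moreover have "epowr (Lp_fun_qnorm M p u) p = (\<integral>\<^sup>+x. ennreal (\<bar>u x\<bar> powr p) \<partial>M)"
    using epowr_epowr_inverse[of "1 / p"] assms(2) by (simp add: Lp_fun_qnorm_eq)
  ultimately show False using assms by (simp add: epowr_ennreal)
qed

lemma Lp_fun_qnorm_AE_zero:
  assumes "AE x in M. u x = 0" "0 < p"
  shows "Lp_fun_qnorm M p u = 0"
proof -
  have "(\<integral>\<^sup>+x. ennreal (\<bar>u x\<bar> powr p) \<partial>M) = (\<integral>\<^sup>+x. 0 \<partial>M)"
    using assms by (intro nn_integral_cong_AE) auto
  then show ?thesis by (simp add: Lp_fun_qnorm_eq epowr_def)
qed

text \<open>Control of single entries is enough, because summability over the scales is regained later from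
  a small loss of smoothness.\<close>

lemma term_le_lq_qnorm:
  assumes "0 < q"
  shows "a k \<le> lq_qnorm q a"
proof (cases "q = \<infinity>")
  case True
  then show ?thesis by (auto simp: lq_qnorm_def intro: SUP_upper)
next
  case False
  then have q: "0 < enn2real q" using assms by (simp add: enn2real_positive_iff less_top)
  have "epowr (a k) (enn2real q) \<le> (\<integral>\<^sup>+j. epowr (a j) (enn2real q) \<partial>count_space UNIV)"
    by (rule nn_integral_ge_point) simp
  then have "epowr (epowr (a k) (enn2real q)) (1 / enn2real q) \<le> lq_qnorm q a"
    using False q by (auto simp: lq_qnorm_def Lp_qnorm_def intro!: epowr_mono)
  then show ?thesis using q by (simp add: epowr_epowr_inverse)
qed

text \<open>Shifting the integer scale by \<open>m\<close> makes it a natural number, so that sums over the occurring scales are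
  ordinary series.\<close>

lemma scale_exists:
  fixes t :: real and m :: nat
  assumes "0 < t" "t < 2 ^ m"
  obtains j :: nat where "2 powi (- (int j - int m) - 1) \<le> t" "t < 2 powi (- (int j - int m))"
proof -
  define l where "l = \<lfloor>log 2 t\<rfloor>"
  have pow: "2 powi k = (2::real) powr (of_int k)" for k :: int
    by (simp add: powr_real_of_int')
  have "log 2 t < real m" using assms by (simp add: log_less_iff powr_realpow)
  then have l: "l < int m" unfolding l_def by linarith
  define j where "j = nat (int m - 1 - l)"
  have j: "- (int j - int m) - 1 = l" "- (int j - int m) = l + 1" using l by (auto simp: j_def)
  have "of_int l \<le> log 2 t" "log 2 t < of_int (l + 1)" unfolding l_def by linarith+
  then have "2 powi l \<le> t" "t < 2 powi (l + 1)"
    unfolding pow using assms by (auto simp: le_log_iff log_less_iff)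
  then show ?thesis using that[of j] j by simp
qed

lemma term_le_suminf:
  fixes f :: "nat \<Rightarrow> ennreal"
  shows "f j \<le> (\<Sum>i. f i)"
  using sum_le_suminf[of f "{j}"] by (simp add: summableI)

context ahlfors_space
begin

text \<open>On a space of diameter below \<open>2\<^sup>m\<close> only the scales \<open>k \<ge> -m\<close> occur. At scale \<open>k\<close> one has
  \<open>d\<^sup>\<alpha> \<le> 2\<^sup>-\<^sup>k\<^sup>(\<^sup>\<alpha>\<^sup>-\<^sup>\<beta>\<^sup>) d\<^sup>\<beta>\<close>, so lowering the smoothness to \<open>\<beta>\<close> produces weights whose \<open>p\<close>-th powers
  form a convergent geometric series. The \<open>\<ell>\<^sup>p\<close> sum of the weighted \<open>g\<^sub>k\<close> is therefore
  in \<open>L\<^sup>p\<close>, and it dominates all of them at once.\<close>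

lemma hajlasz_class_of_gradients:
  assumes "0 < p" "\<beta> < \<alpha>" "0 \<le> C\<^sub>0"
  obtains C where "0 < C"
    "\<And>u g. \<lbrakk>u \<in> borel_measurable M; (\<integral>\<^sup>+x. ennreal (\<bar>u x\<bar> powr p) \<partial>M) \<le> ennreal C\<^sub>0;
       g \<in> frac_gradients M d \<alpha> u; \<And>k. (\<integral>\<^sup>+x. ennreal (g k x powr p) \<partial>M) \<le> ennreal C\<^sub>0\<rbrakk>
       \<Longrightarrow> u \<in> hajlasz_class M d \<beta> p C"
proof -
  obtain D where D: "\<And>x y. x \<in> space M \<Longrightarrow> y \<in> space M \<Longrightarrow> d x y \<le> D"
    using bounded_space by metis
  obtain m :: nat where m: "D < 2 ^ m" using real_arch_pow[of 2 D] by auto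
  define a where "a j = 2 powr ((real m - real j) * (\<alpha> - \<beta>))" for j :: nat
  define r where "r = 2 powr (- ((\<alpha> - \<beta>) * p))"
  have r: "0 < r" "r < 1"
    using powr_less_mono[of "- ((\<alpha> - \<beta>) * p)" 0 2] assms by (auto simp: r_def)
  have a_powr: "a j powr p = 2 powr (real m * (\<alpha> - \<beta>) * p) * r ^ j" for j
  proof -
    have "r ^ j = 2 powr (- ((\<alpha> - \<beta>) * p) * real j)"
      using r(1) powr_realpow[of r j] by (simp add: r_def powr_powr)
    moreover have "a j powr p = 2 powr ((real m - real j) * (\<alpha> - \<beta>) * p)"
      by (simp add: a_def powr_powr)
    moreover have "(real m - real j) * (\<alpha> - \<beta>) * p =
        real m * (\<alpha> - \<beta>) * p + - ((\<alpha> - \<beta>) * p) * real j"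
      by (simp add: algebra_simps)
    ultimately show ?thesis by (simp only: powr_add)
  qed
  define S where "S = (\<Sum>j. a j powr p * C\<^sub>0)"
  have summ: "summable (\<lambda>j. a j powr p * C\<^sub>0)"
    unfolding a_powr using r by (intro summable_mult2 summable_mult summable_geometric) auto
  have S: "0 \<le> S" unfolding S_def using assms by (intro suminf_nonneg summ) auto
  define C where "C = S + C\<^sub>0 + 1"
  have "u \<in> hajlasz_class M d \<beta> p C"
    if um[measurable]: "u \<in> borel_measurable M" and u: "(\<integral>\<^sup>+x. ennreal (\<bar>u x\<bar> powr p) \<partial>M) \<le> ennreal C\<^sub>0"
      and g: "g \<in> frac_gradients M d \<alpha> u" and gC: "\<And>k. (\<integral>\<^sup>+x. ennreal (g k x powr p) \<partial>M) \<le> ennreal C\<^sub>0"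
    for u g
  proof -
    have gm[measurable]: "g k \<in> borel_measurable M" for k using g by (simp add: frac_gradients_def)
    have g0: "0 \<le> g k x" if "x \<in> space M" for k x using g that by (simp add: frac_gradients_def)
    obtain E where E: "E \<in> null_sets M" and grad: "\<And>k x y. \<lbrakk>x \<in> space M - E; y \<in> space M - E;
        2 powi (- k - 1) \<le> d x y; d x y < 2 powi (- k)\<rbrakk> \<Longrightarrow>
        \<bar>u x - u y\<bar> \<le> d x y powr \<alpha> * (g k x + g k y)"
      using g unfolding frac_gradients_def by blast
    define H where "H x = (\<Sum>j. ennreal ((a j * g (int j - int m) x) powr p))" for x
    have Hm[measurable]: "H \<in> borel_measurable M" unfolding H_def by measurable
    have "(\<integral>\<^sup>+x. H x \<partial>M) = (\<Sum>j. \<integral>\<^sup>+x. ennreal ((a j * g (int j - int m) x) powr p) \<partial>M)"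
      unfolding H_def by (intro nn_integral_suminf) measurable
    also have "\<dots> \<le> (\<Sum>j. ennreal (a j powr p * C\<^sub>0))"
    proof (intro suminf_le summableI)
      fix j
      have "(\<integral>\<^sup>+x. ennreal ((a j * g (int j - int m) x) powr p) \<partial>M) =
          (\<integral>\<^sup>+x. ennreal (a j powr p) * ennreal (g (int j - int m) x powr p) \<partial>M)"
        using g0 by (intro nn_integral_cong) (simp add: powr_mult a_def flip: ennreal_mult')
      also have "\<dots> = ennreal (a j powr p) * (\<integral>\<^sup>+x. ennreal (g (int j - int m) x powr p) \<partial>M)"
        by (intro nn_integral_cmult) measurable
      also have "\<dots> \<le> ennreal (a j powr p) * ennreal C\<^sub>0" using gC by (intro mult_left_mono) auto
      finally show "(\<integral>\<^sup>+x. ennreal ((a j * g (int j - int m) x) powr p) \<partial>M) \<le> ennreal (a j powr p * C\<^sub>0)"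
        by (simp add: ennreal_mult')
    qed
    also have "\<dots> = ennreal S"
      unfolding S_def using assms by (intro suminf_ennreal2 summ) auto
    finally have HS: "(\<integral>\<^sup>+x. H x \<partial>M) \<le> ennreal S" .
    define N where "N = {x \<in> space M. H x = \<infinity>}"
    have N: "N \<in> null_sets M"
    proof -
      have "AE x in M. H x \<noteq> \<infinity>"
        using HS by (intro nn_integral_noteq_infinite) (auto simp: top_unique)
      then show ?thesis
        unfolding N_def by (subst (asm) AE_iff_null) simp_all
    qed
    define h where "h x = (enn2real (H x) + \<bar>u x\<bar> powr p) powr (1 / p)" for x
    have root: "t \<le> h x" if "0 \<le> t" "t powr p \<le> enn2real (H x) + \<bar>u x\<bar> powr p" for t x
    proof -
      have "t = (t powr p) powr (1 / p)" using that assms by (simp add: powr_powr)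
      also have "\<dots> \<le> h x" unfolding h_def using that assms by (intro powr_mono2) auto
      finally show ?thesis .
    qed
    have ag: "a j * g (int j - int m) x \<le> h x" if x: "x \<in> space M" "x \<notin> N" for j x
    proof (rule root)
      show "0 \<le> a j * g (int j - int m) x" using g0 x by (simp add: a_def)
      have "ennreal ((a j * g (int j - int m) x) powr p) \<le> H x"
        unfolding H_def by (rule term_le_suminf)
      also have "H x = ennreal (enn2real (H x))" using x by (simp add: N_def less_top)
      finally have "(a j * g (int j - int m) x) powr p \<le> enn2real (H x)" by (simp add: ennreal_le_iff)
      then show "(a j * g (int j - int m) x) powr p \<le> enn2real (H x) + \<bar>u x\<bar> powr p" by (simp add: add_increasing2)
    qed
    have osc: "\<bar>u x - u y\<bar> \<le> d x y powr \<beta> * (h x + h y)"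
      if xy: "x \<in> space M - (E \<union> N)" "y \<in> space M - (E \<union> N)" for x y
    proof (cases "x = y")
      case False
      define t where "t = d x y"
      have t: "0 < t" "t < 2 ^ m" using dist_pos[of x y] D[of x y] False xy m by (auto simp: t_def)
      obtain j :: nat where j: "2 powi (- (int j - int m) - 1) \<le> t" "t < 2 powi (- (int j - int m))"
        by (rule scale_exists[OF t])
      have "2 powi (- (int j - int m)) = (2::real) powr (real m - real j)"
        using powr_real_of_int'[of 2 "- (int j - int m)"] by simp
      then have "t powr (\<alpha> - \<beta>) \<le> a j"
        using j(2) t assms powr_mono2[of "\<alpha> - \<beta>" t "2 powr (real m - real j)"]
        by (simp add: a_def powr_powr)
      then have "t powr \<beta> * t powr (\<alpha> - \<beta>) \<le> t powr \<beta> * a j" by (intro mult_left_mono) auto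
      then have "t powr \<alpha> \<le> t powr \<beta> * a j" by (simp flip: powr_add)
      moreover have "0 \<le> g (int j - int m) x + g (int j - int m) y" using g0 xy by auto
      moreover have "\<bar>u x - u y\<bar> \<le> t powr \<alpha> * (g (int j - int m) x + g (int j - int m) y)"
        using grad[of x y "int j - int m"] xy j unfolding t_def by blast
      ultimately have "\<bar>u x - u y\<bar> \<le> (t powr \<beta> * a j) * (g (int j - int m) x + g (int j - int m) y)"
        by (meson mult_right_mono order_trans)
      also have "\<dots> = t powr \<beta> * (a j * g (int j - int m) x + a j * g (int j - int m) y)"
        by (simp add: algebra_simps)
      also have "\<dots> \<le> t powr \<beta> * (h x + h y)"
        using ag[of x j] ag[of y j] xy by (intro mult_left_mono add_mono) auto
      finally show ?thesis by (simp add: t_def)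
    qed (simp add: h_def)
    have "h \<in> borel_measurable M" unfolding h_def[abs_def] by measurable
    moreover have "\<bar>u x\<bar> \<le> h x" for x by (rule root) auto
    ultimately have "hajlasz_majorant M d \<beta> u (E \<union> N) h"
      unfolding hajlasz_majorant_def using E N osc by blast
    moreover have "(\<integral>\<^sup>+x. ennreal (h x powr p) \<partial>M) \<le> ennreal C"
    proof -
      have "(\<integral>\<^sup>+x. ennreal (h x powr p) \<partial>M) \<le> (\<integral>\<^sup>+x. H x + ennreal (\<bar>u x\<bar> powr p) \<partial>M)"
      proof (intro nn_integral_mono)
        fix x
        have "ennreal (h x powr p) = ennreal (enn2real (H x)) + ennreal (\<bar>u x\<bar> powr p)"
          using assms by (simp add: h_def powr_powr ennreal_plus)
        also have "\<dots> \<le> H x + ennreal (\<bar>u x\<bar> powr p)"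
          by (intro add_right_mono) (cases "H x"; simp)
        finally show "ennreal (h x powr p) \<le> H x + ennreal (\<bar>u x\<bar> powr p)" .
      qed
      also have "\<dots> = (\<integral>\<^sup>+x. H x \<partial>M) + (\<integral>\<^sup>+x. ennreal (\<bar>u x\<bar> powr p) \<partial>M)"
        by (intro nn_integral_add) measurable
      also have "\<dots> \<le> ennreal S + ennreal C\<^sub>0" using HS u by (rule add_mono)
      also have "\<dots> \<le> ennreal C" using S assms by (simp add: C_def flip: ennreal_plus)
      finally show ?thesis .
    qed
    ultimately show ?thesis by (auto simp: hajlasz_class_def)
  qed
  moreover have "0 < C" using S assms by (simp add: C_def)
  ultimately show ?thesis using that by blast
qed

text \<open>Each entry of a sequence is at most its \<open>\<ell>\<^sup>q\<close> norm. Applied pointwise before integrating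
  (Triebel--Lizorkin) or to the sequence of \<open>L\<^sup>p\<close> quasi-norms (Besov), this bounds the entries \<open>g\<^sub>k\<close> in
  \<open>L\<^sup>p\<close> uniformly in \<open>k\<close>.\<close>

lemma HTL_ball_subset_hajlasz_class:
  assumes "0 < p" "\<beta> < \<alpha>" "0 < q" "c < \<infinity>"
  shows "\<exists>C>0. \<forall>u\<in>HTL_space M d \<alpha> p q. HTL_qnorm M d \<alpha> p q u \<le> c \<longrightarrow> u \<in> hajlasz_class M d \<beta> p C"
proof -
  define c' where "c' = enn2real c + 1"
  have c': "c < ennreal c'" "0 \<le> c'" using assms(4) by (cases c; simp add: c'_def ennreal_less_iff)+
  obtain C where C: "0 < C" "\<And>u g. \<lbrakk>u \<in> borel_measurable M; (\<integral>\<^sup>+x. ennreal (\<bar>u x\<bar> powr p) \<partial>M) \<le> ennreal (c' powr p);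
       g \<in> frac_gradients M d \<alpha> u; \<And>k. (\<integral>\<^sup>+x. ennreal (g k x powr p) \<partial>M) \<le> ennreal (c' powr p)\<rbrakk>
       \<Longrightarrow> u \<in> hajlasz_class M d \<beta> p C"
    using hajlasz_class_of_gradients[OF assms(1,2), of "c' powr p"] by auto
  have "u \<in> hajlasz_class M d \<beta> p C" if um: "u \<in> borel_measurable M" and u: "HTL_qnorm M d \<alpha> p q u \<le> c" for u
  proof -
    let ?I = "INF g\<in>frac_gradients M d \<alpha> u. Lp_qnorm M p (\<lambda>x. lq_qnorm q (\<lambda>k. ennreal (g k x)))"
    have "Lp_fun_qnorm M p u \<le> HTL_qnorm M d \<alpha> p q u" "?I \<le> HTL_qnorm M d \<alpha> p q u"
      by (auto simp: HTL_qnorm_def)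
    then have le: "Lp_fun_qnorm M p u \<le> ennreal c'" "?I < ennreal c'"
      using u c' by (meson order_trans less_imp_le le_less_trans)+
    then obtain g where g: "g \<in> frac_gradients M d \<alpha> u"
      "Lp_qnorm M p (\<lambda>x. lq_qnorm q (\<lambda>k. ennreal (g k x))) < ennreal c'"
      by (auto simp: INF_less_iff)
    have "(\<integral>\<^sup>+x. epowr (lq_qnorm q (\<lambda>k. ennreal (g k x))) p \<partial>M) \<le> ennreal (c' powr p)"
      using le_epowr_of_epowr_inverse_le[OF less_imp_le[OF g(2)[unfolded Lp_qnorm_def]] assms(1)] c'
      by (simp add: epowr_ennreal)
    moreover have "(\<integral>\<^sup>+x. ennreal (g k x powr p) \<partial>M) \<le> (\<integral>\<^sup>+x. epowr (lq_qnorm q (\<lambda>k. ennreal (g k x))) p \<partial>M)" for k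
    proof (intro nn_integral_mono)
      fix x assume "x \<in> space M"
      then have "ennreal (g k x powr p) = epowr (ennreal (g k x)) p"
        using g(1) by (simp add: frac_gradients_def epowr_ennreal)
      also have "\<dots> \<le> epowr (lq_qnorm q (\<lambda>k. ennreal (g k x))) p"
        using assms term_le_lq_qnorm[of q "\<lambda>k. ennreal (g k x)" k] by (intro epowr_mono) auto
      finally show "ennreal (g k x powr p) \<le> epowr (lq_qnorm q (\<lambda>k. ennreal (g k x))) p" .
    qed
    moreover have "(\<integral>\<^sup>+x. ennreal (\<bar>u x\<bar> powr p) \<partial>M) \<le> ennreal (c' powr p)"
      using le_epowr_of_epowr_inverse_le[OF le(1)[unfolded Lp_fun_qnorm_eq] assms(1)] c'
      by (simp add: epowr_ennreal)
    ultimately show ?thesis using C(2)[OF um _ g(1)] order_trans by blast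
  qed
  then show ?thesis
    using C(1) by (intro exI[of _ C]) (simp add: HTL_space_def Lp_fun_space_def)
qed

lemma HB_ball_subset_hajlasz_class:
  assumes "0 < p" "\<beta> < \<alpha>" "0 < q" "c < \<infinity>"
  shows "\<exists>C>0. \<forall>u\<in>HB_space M d \<alpha> p q. HB_qnorm M d \<alpha> p q u \<le> c \<longrightarrow> u \<in> hajlasz_class M d \<beta> p C"
proof -
  define c' where "c' = enn2real c + 1"
  have c': "c < ennreal c'" "0 \<le> c'" using assms(4) by (cases c; simp add: c'_def ennreal_less_iff)+
  obtain C where C: "0 < C" "\<And>u g. \<lbrakk>u \<in> borel_measurable M; (\<integral>\<^sup>+x. ennreal (\<bar>u x\<bar> powr p) \<partial>M) \<le> ennreal (c' powr p);
       g \<in> frac_gradients M d \<alpha> u; \<And>k. (\<integral>\<^sup>+x. ennreal (g k x powr p) \<partial>M) \<le> ennreal (c' powr p)\<rbrakk>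
       \<Longrightarrow> u \<in> hajlasz_class M d \<beta> p C"
    using hajlasz_class_of_gradients[OF assms(1,2), of "c' powr p"] by auto
  have "u \<in> hajlasz_class M d \<beta> p C" if um: "u \<in> borel_measurable M" and u: "HB_qnorm M d \<alpha> p q u \<le> c" for u
  proof -
    let ?I = "INF g\<in>frac_gradients M d \<alpha> u. lq_qnorm q (\<lambda>k. Lp_fun_qnorm M p (g k))"
    have "Lp_fun_qnorm M p u \<le> HB_qnorm M d \<alpha> p q u" "?I \<le> HB_qnorm M d \<alpha> p q u"
      by (auto simp: HB_qnorm_def)
    then have le: "Lp_fun_qnorm M p u \<le> ennreal c'" "?I < ennreal c'"
      using u c' by (meson order_trans less_imp_le le_less_trans)+
    then obtain g where g: "g \<in> frac_gradients M d \<alpha> u"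
      "lq_qnorm q (\<lambda>k. Lp_fun_qnorm M p (g k)) < ennreal c'"
      by (auto simp: INF_less_iff)
    have bound: "(\<integral>\<^sup>+x. ennreal (\<bar>v x\<bar> powr p) \<partial>M) \<le> ennreal (c' powr p)"
      if "Lp_fun_qnorm M p v \<le> ennreal c'" for v
      using le_epowr_of_epowr_inverse_le[OF that[unfolded Lp_fun_qnorm_eq] assms(1)] c'
      by (simp add: epowr_ennreal)
    have "(\<integral>\<^sup>+x. ennreal (g k x powr p) \<partial>M) \<le> ennreal (c' powr p)" for k
    proof -
      have "Lp_fun_qnorm M p (g k) \<le> ennreal c'"
        using term_le_lq_qnorm[OF assms(3), of "\<lambda>k. Lp_fun_qnorm M p (g k)" k] g(2)
        by (meson less_imp_le order_trans)
      then have "(\<integral>\<^sup>+x. ennreal (\<bar>g k x\<bar> powr p) \<partial>M) \<le> ennreal (c' powr p)" by (rule bound)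
      moreover have "(\<integral>\<^sup>+x. ennreal (g k x powr p) \<partial>M) = (\<integral>\<^sup>+x. ennreal (\<bar>g k x\<bar> powr p) \<partial>M)"
        using g(1) by (intro nn_integral_cong) (simp add: frac_gradients_def)
      ultimately show ?thesis by simp
    qed
    then show ?thesis using C(2)[OF um _ g(1)] bound[OF le(1)] by blast
  qed
  then show ?thesis
    using C(1) by (intro exI[of _ C]) (simp add: HB_space_def Lp_fun_space_def)
qed

end

section \<open>Compactness in Lebesgue spaces\<close>

text \<open>One representative is chosen for each code. The centres thus lie in the set itself, as total
  boundedness requires; passing from outside centres to inside ones would cost a quasi-triangle inequality.\<close>

lemma qnorm_totally_bounded_by_finite_codes:
  fixes N :: "('a \<Rightarrow> real) \<Rightarrow> ennreal"
  assumes "\<And>e. 0 < e \<Longrightarrow> \<exists>\<Phi> :: ('a \<Rightarrow> real) \<Rightarrow> 'c. finite (\<Phi> ` B) \<and>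
    (\<forall>v\<in>B. \<forall>w\<in>B. \<Phi> v = \<Phi> w \<longrightarrow> N (\<lambda>x. v x - w x) < ennreal e)"
  shows "qnorm_totally_bounded N B"
  unfolding qnorm_totally_bounded_def
proof (intro allI impI)
  fix e :: real assume "0 < e"
  then obtain \<Phi> :: "('a \<Rightarrow> real) \<Rightarrow> 'c" where \<Phi>: "finite (\<Phi> ` B)"
    "\<And>v w. v \<in> B \<Longrightarrow> w \<in> B \<Longrightarrow> \<Phi> v = \<Phi> w \<Longrightarrow> N (\<lambda>x. v x - w x) < ennreal e"
    using assms by metis
  show "\<exists>K. finite K \<and> K \<subseteq> B \<and> (\<forall>v\<in>B. \<exists>w\<in>K. N (\<lambda>x. v x - w x) < ennreal e)"
  proof (intro exI[of _ "inv_into B \<Phi> ` \<Phi> ` B"] conjI ballI)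
    show "finite (inv_into B \<Phi> ` \<Phi> ` B)" using \<Phi>(1) by simp
    show "inv_into B \<Phi> ` \<Phi> ` B \<subseteq> B" by (auto intro: inv_into_into)
    fix v assume v: "v \<in> B"
    then show "\<exists>w\<in>inv_into B \<Phi> ` \<Phi> ` B. N (\<lambda>x. v x - w x) < ennreal e"
      by (intro bexI[of _ "inv_into B \<Phi> (\<Phi> v)"] \<Phi>(2)) (auto intro: inv_into_into simp: f_inv_into_f)
  qed
qed

lemma finite_rounded_values:
  fixes f :: "'v \<Rightarrow> 'a \<Rightarrow> real"
  assumes "finite F" "0 < e" "\<And>v i. v \<in> B \<Longrightarrow> i \<in> F \<Longrightarrow> \<bar>f v i\<bar> \<le> L"
  shows "finite ((\<lambda>v. restrict (\<lambda>i. \<lfloor>f v i / e\<rfloor>) F) ` B)"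
proof (rule finite_subset)
  show "(\<lambda>v. restrict (\<lambda>i. \<lfloor>f v i / e\<rfloor>) F) ` B \<subseteq> (\<Pi>\<^sub>E i\<in>F. {\<lfloor>- L / e\<rfloor>..\<lfloor>L / e\<rfloor>})"
  proof (rule image_subsetI)
    fix v assume v: "v \<in> B"
    have "f v i / e \<le> L / e" "- L / e \<le> f v i / e" if "i \<in> F" for i
      using assms(3)[OF v that] assms(2) divide_right_mono[of "f v i" L e] divide_right_mono[of "- L" "f v i" e]
      by auto
    then show "restrict (\<lambda>i. \<lfloor>f v i / e\<rfloor>) F \<in> (\<Pi>\<^sub>E i\<in>F. {\<lfloor>- L / e\<rfloor>..\<lfloor>L / e\<rfloor>})"
      by (auto intro!: floor_mono)
  qed
  show "finite (\<Pi>\<^sub>E i\<in>F. {\<lfloor>- L / e\<rfloor>..\<lfloor>L / e\<rfloor>})" using assms(1) by (intro finite_PiE) auto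
qed

lemma rounded_values_eqD:
  fixes a b e :: real
  assumes "\<lfloor>a / e\<rfloor> = \<lfloor>b / e\<rfloor>" "0 < e"
  shows "\<bar>a - b\<bar> \<le> e"
proof -
  have "\<bar>a / e - b / e\<bar> \<le> 1" using assms(1) by linarith
  then have "e * \<bar>a / e - b / e\<bar> \<le> e * 1" using assms(2) by (intro mult_left_mono) auto
  moreover have "a / e - b / e = (a - b) / e" by (rule diff_divide_distrib[symmetric])
  ultimately show ?thesis using assms(2) by (simp add: abs_divide)
qed

lemma powr_abs_diff_le:
  fixes a b r :: real
  assumes "0 < r"
  shows "\<bar>a - b\<bar> powr r \<le> 2 powr r * (\<bar>a\<bar> powr r + \<bar>b\<bar> powr r)"
proof -
  have "\<bar>a - b\<bar> powr r \<le> (2 * max \<bar>a\<bar> \<bar>b\<bar>) powr r" using assms by (intro powr_mono2) auto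
  also have "\<dots> = 2 powr r * (max \<bar>a\<bar> \<bar>b\<bar>) powr r" by (simp add: powr_mult)
  also have "\<dots> \<le> 2 powr r * (\<bar>a\<bar> powr r + \<bar>b\<bar> powr r)" by (intro mult_left_mono) (auto simp: max_def)
  finally show ?thesis .
qed

text \<open>This pointwise bound turns convergence in measure together with a bound on the \<open>r\<close>-th moment
  into convergence of the \<open>p'\<close>-th moment: values up to \<open>e\<close> are
  small, values between \<open>e\<close> and \<open>T\<close> are bounded and occur on a small set, and values above
  \<open>T\<close> are controlled by the \<open>r\<close>-th moment because \<open>T powr (p' - r)\<close> is small for large \<open>T\<close>.\<close>

lemma powr_split_le:
  fixes t e T r p' :: real
  assumes "0 < p'" "p' < r" "0 < e" "0 < T" "0 \<le> t"
  shows "t powr p' \<le> e powr p' + (if e < t then T powr p' else 0) + T powr (p' - r) * t powr r"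
proof -
  consider "t \<le> e" | "e < t" "t \<le> T" | "T < t" by linarith
  then show ?thesis
  proof cases
    case 1
    then have "t powr p' \<le> e powr p'" using assms by (intro powr_mono2) auto
    then show ?thesis by (simp add: add_increasing2)
  next
    case 2
    then have "t powr p' \<le> T powr p'" using assms by (intro powr_mono2) auto
    then show ?thesis using 2 by (simp add: add_increasing2 add_increasing)
  next
    case 3
    have "t powr p' = t powr (p' - r) * t powr r" by (simp flip: powr_add)
    also have "\<dots> \<le> T powr (p' - r) * t powr r"
      using assms 3 by (intro mult_right_mono powr_mono2') auto
    finally show ?thesis by (simp add: add_increasing)
  qed
qed

context ahlfors_space
begin

text \<open>The good set is where the majorant is at most \<open>\<kappa>\<close>; by the Markov inequality its complement is
  small, uniformly over the class.\<close>

lemma hajlasz_class_good_set: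
  assumes "0 < p" "0 < C" "0 < \<eta>"
  shows "\<exists>\<kappa>>0. \<forall>u\<in>hajlasz_class M d \<beta> p C. \<exists>G\<in>sets M. emeasure M (space M - G) \<le> ennreal \<eta> \<and>
       (\<forall>x\<in>G. \<bar>u x\<bar> \<le> \<kappa>) \<and> (\<forall>x\<in>G. \<forall>y\<in>G. \<bar>u x - u y\<bar> \<le> d x y powr \<beta> * (2 * \<kappa>))"
proof -
  define \<kappa> where "\<kappa> = (C / \<eta>) powr (1 / p)"
  have \<kappa>: "0 < \<kappa>" "\<kappa> powr p = C / \<eta>" using assms by (auto simp: \<kappa>_def powr_powr)
  have "\<exists>G\<in>sets M. emeasure M (space M - G) \<le> ennreal \<eta> \<and>
       (\<forall>x\<in>G. \<bar>u x\<bar> \<le> \<kappa>) \<and> (\<forall>x\<in>G. \<forall>y\<in>G. \<bar>u x - u y\<bar> \<le> d x y powr \<beta> * (2 * \<kappa>))"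
    if u: "u \<in> hajlasz_class M d \<beta> p C" for u
  proof -
    obtain E h where maj: "hajlasz_majorant M d \<beta> u E h"
      and int: "(\<integral>\<^sup>+x. ennreal (h x powr p) \<partial>M) \<le> ennreal C"
      using u by (auto simp: hajlasz_class_def)
    have hm[measurable]: "h \<in> borel_measurable M" and E: "E \<in> null_sets M"
      using maj by (simp_all add: hajlasz_majorant_def)
    define A where "A = {x \<in> space M. \<kappa> < h x}"
    have A: "A \<in> sets M" unfolding A_def by measurable
    define G where "G = space M - (A \<union> E)"
    have G: "G \<in> sets M" using A E by (auto simp: G_def)
    have "ennreal (C / \<eta>) * emeasure M A = (\<integral>\<^sup>+x. ennreal (C / \<eta>) * indicator A x \<partial>M)"
      using A by (simp add: nn_integral_cmult_indicator)
    also have "\<dots> \<le> (\<integral>\<^sup>+x. ennreal (h x powr p) \<partial>M)"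
    proof (intro nn_integral_mono)
      fix x
      show "ennreal (C / \<eta>) * indicator A x \<le> ennreal (h x powr p)"
        using \<kappa> assms unfolding \<kappa>(2)[symmetric]
        by (auto simp: A_def split: split_indicator intro!: ennreal_leI powr_mono2)
    qed
    also have "\<dots> \<le> ennreal C" by (rule int)
    finally have "ennreal (C / \<eta>) * ennreal (measure M A) \<le> ennreal C"
      by (simp add: emeasure_eq_measure)
    then have "C / \<eta> * measure M A \<le> C"
      using assms by (simp add: ennreal_le_iff flip: ennreal_mult')
    then have "measure M A \<le> \<eta>" using assms by (simp add: field_simps)
    moreover have "space M - G = A \<union> E" using A E sets.sets_into_space by (auto simp: G_def)
    ultimately have "emeasure M (space M - G) \<le> ennreal \<eta>"
      using emeasure_Un_null_set[OF A E] by (simp add: emeasure_eq_measure[of A] ennreal_leI)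
    moreover have "\<bar>u x\<bar> \<le> \<kappa>" if "x \<in> G" for x
    proof -
      have "\<bar>u x\<bar> \<le> h x" using maj that unfolding hajlasz_majorant_def G_def by blast
      moreover have "h x \<le> \<kappa>" using that by (auto simp: G_def A_def not_less)
      ultimately show ?thesis by linarith
    qed
    moreover have "\<bar>u x - u y\<bar> \<le> d x y powr \<beta> * (2 * \<kappa>)" if "x \<in> G" "y \<in> G" for x y
    proof -
      have "\<bar>u x - u y\<bar> \<le> d x y powr \<beta> * (h x + h y)"
        using maj that unfolding hajlasz_majorant_def G_def by blast
      also have "\<dots> \<le> d x y powr \<beta> * (2 * \<kappa>)"
        using that by (intro mult_left_mono) (auto simp: G_def A_def not_less)
      finally show ?thesis .
    qed
    ultimately show ?thesis using G by blast
  qed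
  then show ?thesis using \<kappa>(1) by blast
qed

text \<open>A function is sampled, near each point of a net, at some point of its own good set if there is one
  nearby. Two functions with equal codes then differ by at most \<open>e\<close> on the intersection of
  their good sets, whose complement has measure at most \<open>2 * \<eta>\<close>. The sampling points depend on the
  function, which does no harm because only the sampled values are compared.\<close>

lemma hajlasz_class_totally_bounded_Lp:
  assumes pos: "0 < p" "0 < \<beta>" "0 < C" and p': "0 < p'" "p' < r" and C': "0 \<le> C'"
    and B: "\<And>u. u \<in> B \<Longrightarrow> u \<in> borel_measurable M" "\<And>u. u \<in> B \<Longrightarrow> u \<in> hajlasz_class M d \<beta> p C"
      "\<And>u. u \<in> B \<Longrightarrow> (\<integral>\<^sup>+x. ennreal (\<bar>u x\<bar> powr r) \<partial>M) \<le> ennreal C'"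
  shows "qnorm_totally_bounded (Lp_fun_qnorm M p') B"
proof (rule qnorm_totally_bounded_by_finite_codes)
  fix \<epsilon> :: real assume \<epsilon>: "0 < \<epsilon>"
  \<comment> \<open>The parameters \<open>e\<close>, \<open>T\<close> and \<open>\<eta>\<close> make each of the three contributions at most \<open>\<epsilon>' / 4\<close>.\<close>
  define \<epsilon>' where "\<epsilon>' = \<epsilon> powr p'"
  have \<epsilon>': "0 < \<epsilon>'" using \<epsilon> by (simp add: \<epsilon>'_def)
  define \<mu> where "\<mu> = measure M (space M)"
  have \<mu>: "0 \<le> \<mu>" by (simp add: \<mu>_def)
  define e where "e = (\<epsilon>' / (4 * (\<mu> + 1))) powr (1 / p')"
  have e: "0 < e" "e powr p' = \<epsilon>' / (4 * (\<mu> + 1))" using \<epsilon>' \<mu> p' by (auto simp: e_def powr_powr)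
  have e_bound: "e powr p' * \<mu> \<le> \<epsilon>' / 4"
    unfolding e(2) using \<epsilon>' \<mu> by (simp add: field_simps)
  define T where "T = (\<epsilon>' / (4 * (2 powr r * (2 * C') + 1))) powr (1 / (p' - r))"
  have den: "0 < 2 powr r * (2 * C') + 1" using C' by (intro add_nonneg_pos) auto
  have T: "0 < T" "T powr (p' - r) = \<epsilon>' / (4 * (2 powr r * (2 * C') + 1))"
    using \<epsilon>' den p' by (auto simp: T_def powr_powr)
  have T_bound: "T powr (p' - r) * (2 powr r * (2 * C')) \<le> \<epsilon>' / 4"
    unfolding T(2) using \<epsilon>' den by (simp add: field_simps)
  define \<eta> where "\<eta> = \<epsilon>' / (8 * T powr p')"
  have \<eta>: "0 < \<eta>" "T powr p' * (2 * \<eta>) = \<epsilon>' / 4" using \<epsilon>' T by (auto simp: \<eta>_def)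
  obtain \<kappa> where \<kappa>: "0 < \<kappa>" and "\<forall>u\<in>hajlasz_class M d \<beta> p C. \<exists>G\<in>sets M. emeasure M (space M - G) \<le> ennreal \<eta> \<and>
       (\<forall>x\<in>G. \<bar>u x\<bar> \<le> \<kappa>) \<and> (\<forall>x\<in>G. \<forall>y\<in>G. \<bar>u x - u y\<bar> \<le> d x y powr \<beta> * (2 * \<kappa>))"
    using hajlasz_class_good_set[OF pos(1,3) \<eta>(1)] by metis
  then have "\<forall>u\<in>B. \<exists>G. G \<in> sets M \<and> emeasure M (space M - G) \<le> ennreal \<eta> \<and>
       (\<forall>x\<in>G. \<bar>u x\<bar> \<le> \<kappa>) \<and> (\<forall>x\<in>G. \<forall>y\<in>G. \<bar>u x - u y\<bar> \<le> d x y powr \<beta> * (2 * \<kappa>))"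
    using B(2) by blast
  then obtain G where G': "\<forall>u\<in>B. G u \<in> sets M \<and> emeasure M (space M - G u) \<le> ennreal \<eta> \<and>
       (\<forall>x\<in>G u. \<bar>u x\<bar> \<le> \<kappa>) \<and> (\<forall>x\<in>G u. \<forall>y\<in>G u. \<bar>u x - u y\<bar> \<le> d x y powr \<beta> * (2 * \<kappa>))"
    by (rule exE[OF bchoice])
  have G: "\<And>u. u \<in> B \<Longrightarrow> G u \<in> sets M"
      "\<And>u. u \<in> B \<Longrightarrow> emeasure M (space M - G u) \<le> ennreal \<eta>"
      "\<And>u x. u \<in> B \<Longrightarrow> x \<in> G u \<Longrightarrow> \<bar>u x\<bar> \<le> \<kappa>"
      "\<And>u x y. u \<in> B \<Longrightarrow> x \<in> G u \<Longrightarrow> y \<in> G u \<Longrightarrow> \<bar>u x - u y\<bar> \<le> d x y powr \<beta> * (2 * \<kappa>)"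
    using G' by blast+
  have Gs: "x \<in> space M" if "u \<in> B" "x \<in> G u" for u x
    using G(1)[OF that(1)] that(2) sets.sets_into_space by blast
  define \<rho> where "\<rho> = (e / (6 * \<kappa>)) powr (1 / \<beta>)"
  have \<rho>: "0 < \<rho>" "\<rho> powr \<beta> = e / (6 * \<kappa>)" using e \<kappa> pos by (auto simp: \<rho>_def powr_powr)
  have "0 < \<rho> / K\<^sup>2" using \<rho> K_pos by simp
  then obtain F where F: "finite F" "F \<subseteq> space M" "\<And>x. x \<in> space M \<Longrightarrow> \<exists>y\<in>F. d y x < \<rho> / K\<^sup>2"
    using finite_net by blast
  have near: "\<bar>u x - u y\<bar> \<le> e / 3" if "u \<in> B" "x \<in> G u" "y \<in> G u" "i \<in> F" "d i x < \<rho> / K\<^sup>2" "d i y < \<rho> / K\<^sup>2" for u x y i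
  proof -
    have s: "x \<in> space M" "y \<in> space M" "i \<in> space M" using that Gs F(2) by auto
    have "d x y \<le> K\<^sup>2 * (\<rho> / K\<^sup>2)" using that s by (intro dist_le_from_center[of x y i]) auto
    then have "d x y \<le> \<rho>" using K_pos by simp
    then have "d x y powr \<beta> \<le> e / (6 * \<kappa>)"
      unfolding \<rho>(2)[symmetric] using pos nonneg s by (intro powr_mono2) auto
    then have "d x y powr \<beta> * (2 * \<kappa>) \<le> e / (6 * \<kappa>) * (2 * \<kappa>)" using \<kappa> by (intro mult_right_mono) auto
    then show ?thesis using G(4)[OF that(1-3)] \<kappa> by simp
  qed
  define pt where "pt u i = (SOME x. x \<in> G u \<and> d i x < \<rho> / K\<^sup>2)" for u i
  have pt: "pt u i \<in> G u \<and> d i (pt u i) < \<rho> / K\<^sup>2" if "x \<in> G u" "d i x < \<rho> / K\<^sup>2" for u i x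
    unfolding pt_def by (rule someI) (use that in blast)
  define val where "val u i = (if \<exists>x. x \<in> G u \<and> d i x < \<rho> / K\<^sup>2 then u (pt u i) else 0)" for u i
  have val: "\<bar>val u i\<bar> \<le> \<kappa>" if "u \<in> B" for u i
    unfolding val_def using G(3)[OF that] pt \<kappa> by auto
  define \<Phi> where "\<Phi> u = restrict (\<lambda>i. \<lfloor>val u i / (e / 3)\<rfloor>) F" for u
  have "finite (\<Phi> ` B)"
    unfolding \<Phi>_def using F(1) e val by (intro finite_rounded_values[where L = \<kappa>]) auto
  moreover have "Lp_fun_qnorm M p' (\<lambda>x. v x - w x) < ennreal \<epsilon>"
    if vw: "v \<in> B" "w \<in> B" "\<Phi> v = \<Phi> w" for v w
  proof -
    have [measurable]: "v \<in> borel_measurable M" "w \<in> borel_measurable M" "G v \<in> sets M" "G w \<in> sets M"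
      using B(1) G(1) vw by auto
    define Nv where "Nv = space M - G v"
    define Nw where "Nw = space M - G w"
    have [measurable]: "Nv \<in> sets M" "Nw \<in> sets M" by (auto simp: Nv_def Nw_def)
    have close: "\<bar>v x - w x\<bar> \<le> e" if x: "x \<in> G v" "x \<in> G w" for x
    proof -
      obtain i where i: "i \<in> F" "d i x < \<rho> / K\<^sup>2" using F(3) Gs vw(1) x(1) by blast
      have "\<lfloor>val v i / (e / 3)\<rfloor> = \<lfloor>val w i / (e / 3)\<rfloor>"
        using fun_cong[OF vw(3), of i] i by (simp add: \<Phi>_def)
      then have "\<bar>val v i - val w i\<bar> \<le> e / 3" using e by (intro rounded_values_eqD) auto
      moreover have "\<bar>v x - val v i\<bar> \<le> e / 3"
        using near[of v x "pt v i" i] vw x i pt[OF x(1) i(2)] by (auto simp: val_def)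
      moreover have "\<bar>w x - val w i\<bar> \<le> e / 3"
        using near[of w x "pt w i" i] vw x i pt[OF x(2) i(2)] by (auto simp: val_def)
      ultimately show ?thesis by linarith
    qed
    define c where "c = T powr (p' - r) * 2 powr r"
    have c: "0 \<le> c" by (simp add: c_def)
    have "(\<integral>\<^sup>+x. ennreal (\<bar>v x - w x\<bar> powr p') \<partial>M) \<le>
        (\<integral>\<^sup>+x. ennreal (e powr p') + ennreal (T powr p') * (indicator Nv x + indicator Nw x) +
           ennreal c * (ennreal (\<bar>v x\<bar> powr r) + ennreal (\<bar>w x\<bar> powr r)) \<partial>M)"
    proof (intro nn_integral_mono)
      fix x assume x: "x \<in> space M"
      let ?t = "\<bar>v x - w x\<bar>"
      have "T powr (p' - r) * ?t powr r \<le> c * (\<bar>v x\<bar> powr r + \<bar>w x\<bar> powr r)"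
        unfolding c_def mult.assoc using powr_abs_diff_le[of r "v x" "w x"] p'
        by (intro mult_left_mono) auto
      moreover have "?t powr p' \<le> e powr p' + (if e < ?t then T powr p' else 0) + T powr (p' - r) * ?t powr r"
        using p' e T by (intro powr_split_le) auto
      moreover have "(if e < ?t then T powr p' else 0) \<le> T powr p' * (indicator Nv x + indicator Nw x)"
        using close[of x] x T by (auto simp: Nv_def Nw_def split: split_indicator)
      ultimately have "?t powr p' \<le> e powr p' + T powr p' * (indicator Nv x + indicator Nw x) +
          c * (\<bar>v x\<bar> powr r + \<bar>w x\<bar> powr r)" by linarith
      then have "ennreal (?t powr p') \<le> ennreal (e powr p' + T powr p' * (indicator Nv x + indicator Nw x) +
          c * (\<bar>v x\<bar> powr r + \<bar>w x\<bar> powr r))" by (rule ennreal_leI)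
      also have "\<dots> = ennreal (e powr p') + ennreal (T powr p') * (indicator Nv x + indicator Nw x) +
           ennreal c * (ennreal (\<bar>v x\<bar> powr r) + ennreal (\<bar>w x\<bar> powr r))"
        using c by (simp add: ennreal_plus ennreal_mult' ennreal_indicator)
      finally show "ennreal (?t powr p') \<le> \<dots>" .
    qed
    also have "\<dots> = ennreal (e powr p') * emeasure M (space M) +
        ennreal (T powr p') * (emeasure M Nv + emeasure M Nw) +
        ennreal c * ((\<integral>\<^sup>+x. ennreal (\<bar>v x\<bar> powr r) \<partial>M) + (\<integral>\<^sup>+x. ennreal (\<bar>w x\<bar> powr r) \<partial>M))"
      by (simp add: nn_integral_add nn_integral_cmult)
    also have "\<dots> \<le> ennreal (e powr p') * ennreal \<mu> + ennreal (T powr p') * (ennreal \<eta> + ennreal \<eta>) +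
        ennreal c * (ennreal C' + ennreal C')"
      using G(2) B(3) vw unfolding Nv_def Nw_def
      by (intro add_mono mult_left_mono) (auto simp: \<mu>_def emeasure_eq_measure)
    also have "\<dots> = ennreal (e powr p' * \<mu> + T powr p' * (2 * \<eta>) + T powr (p' - r) * (2 powr r * (2 * C')))"
      using c \<mu> \<eta>(1) C' by (simp add: ennreal_plus ennreal_mult' c_def mult.assoc flip: mult_2)
    also have "\<dots> < ennreal (\<epsilon> powr p')"
      using e_bound T_bound \<eta>(2) \<epsilon>' unfolding \<epsilon>'_def[symmetric] by (intro ennreal_lessI) linarith+
    finally show ?thesis using p' \<epsilon> by (intro Lp_fun_qnorm_less) auto
  qed
  ultimately show "\<exists>\<Phi> :: ('a \<Rightarrow> real) \<Rightarrow> 'a \<Rightarrow> int. finite (\<Phi> ` B) \<and>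
      (\<forall>v\<in>B. \<forall>w\<in>B. \<Phi> v = \<Phi> w \<longrightarrow> Lp_fun_qnorm M p' (\<lambda>x. v x - w x) < ennreal \<epsilon>)"
    by (intro exI[of _ \<Phi>]) blast
qed

lemma Lp_fun_space_of_higher_integrability:
  assumes "0 < p'" "p' < r" "u \<in> borel_measurable M" "(\<integral>\<^sup>+x. ennreal (\<bar>u x\<bar> powr r) \<partial>M) \<le> ennreal C'"
  shows "u \<in> Lp_fun_space M p'"
proof -
  have [measurable]: "u \<in> borel_measurable M" by fact
  have "t powr p' \<le> 2 + t powr r" if "0 \<le> t" for t :: real
    using powr_split_le[of p' r 1 1 t] assms(1,2) that by (auto split: if_splits)
  then have "(\<integral>\<^sup>+x. ennreal (\<bar>u x\<bar> powr p') \<partial>M) \<le> (\<integral>\<^sup>+x. ennreal (2 + \<bar>u x\<bar> powr r) \<partial>M)"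
    by (intro nn_integral_mono ennreal_leI) simp
  also have "\<dots> = 2 * emeasure M (space M) + (\<integral>\<^sup>+x. ennreal (\<bar>u x\<bar> powr r) \<partial>M)"
    by (simp add: nn_integral_add ennreal_plus)
  also have "\<dots> < \<infinity>"
    using finite_total le_less_trans[OF assms(4) ennreal_less_top] by (simp add: ennreal_mult_less_top)
  finally show ?thesis using assms by (simp add: Lp_fun_space_def Lp_fun_qnorm_eq del: infinity_ennreal_def)
qed

lemma compact_embedding_Lp:
  assumes pos: "0 < p" "0 < \<beta>" and sub: "\<beta> * p < s" and p': "0 < p'" "p' < s * p / (s - \<beta> * p)"
    and S: "\<And>u. u \<in> S \<Longrightarrow> u \<in> borel_measurable M" "\<And>u. u \<in> S \<Longrightarrow> NS u < \<infinity>"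
      "\<And>c. c < \<infinity> \<Longrightarrow> \<exists>C>0. \<forall>u\<in>S. NS u \<le> c \<longrightarrow> u \<in> hajlasz_class M d \<beta> p C"
  shows "compact_embedding M S NS (Lp_fun_space M p') (Lp_fun_qnorm M p')"
  unfolding compact_embedding_def
proof (intro conjI allI impI)
  show "natural_map_well_defined M S (Lp_fun_space M p') (Lp_fun_qnorm M p')"
    unfolding natural_map_well_defined_def
  proof
    fix u assume u: "u \<in> S"
    obtain C where C: "0 < C" "u \<in> hajlasz_class M d \<beta> p C" using S(3)[OF S(2)[OF u]] u by blast
    then obtain C' where "(\<integral>\<^sup>+x. ennreal (\<bar>u x\<bar> powr (s * p / (s - \<beta> * p))) \<partial>M) \<le> ennreal C'"
      using hajlasz_class_higher_integrability[OF pos less_imp_le[OF C(1)] sub] by metis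
    then have "u \<in> Lp_fun_space M p'"
      using Lp_fun_space_of_higher_integrability[OF p' S(1)[OF u]] by blast
    moreover have "Lp_fun_qnorm M p' (\<lambda>x. u x - w x) = 0" if "AE x in M. u x = w x" for w
      using that p' by (intro Lp_fun_qnorm_AE_zero) auto
    ultimately show "\<exists>v\<in>Lp_fun_space M p'. (AE x in M. u x = v x) \<and>
        (\<forall>w\<in>Lp_fun_space M p'. (AE x in M. u x = w x) \<longrightarrow> Lp_fun_qnorm M p' (\<lambda>x. v x - w x) = 0)"
      by (intro bexI[of _ u]) auto
  qed
  fix A assume A: "A \<subseteq> S" "qnorm_bounded NS A"
  then obtain c where c: "c < \<infinity>" "\<And>u. u \<in> A \<Longrightarrow> NS u \<le> c" by (auto simp: qnorm_bounded_def)
  then obtain C where C: "0 < C" "\<And>u. u \<in> A \<Longrightarrow> u \<in> hajlasz_class M d \<beta> p C"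
    using S(3)[OF c(1)] A(1) by blast
  obtain C' where C': "0 \<le> C'" "\<And>u. u \<in> hajlasz_class M d \<beta> p C \<Longrightarrow>
       (\<integral>\<^sup>+x. ennreal (\<bar>u x\<bar> powr (s * p / (s - \<beta> * p))) \<partial>M) \<le> ennreal C'"
    using hajlasz_class_higher_integrability[OF pos less_imp_le[OF C(1)] sub] by metis
  have img: "v \<in> borel_measurable M" "v \<in> hajlasz_class M d \<beta> p C"
    if "v \<in> natural_image M (Lp_fun_space M p') A" for v
    using that by (auto simp: natural_image_def Lp_fun_space_def intro: hajlasz_class_cong_AE[OF C(2)])
  show "qnorm_totally_bounded (Lp_fun_qnorm M p') (natural_image M (Lp_fun_space M p') A)"
    by (rule hajlasz_class_totally_bounded_Lp[OF pos C(1) p' C'(1)]) (use img C'(2) in auto)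
qed

end

section \<open>Compactness in Hoelder spaces\<close>

lemma exists_small_radius:
  fixes L e \<gamma> :: real
  assumes "0 \<le> L" "0 < \<gamma>" "0 < e"
  obtains r where "0 < r" "\<And>t. 0 \<le> t \<Longrightarrow> t \<le> r \<Longrightarrow> L * t powr \<gamma> \<le> e"
proof
  let ?r = "(e / (L + 1)) powr (1 / \<gamma>)"
  show "0 < ?r" using assms by simp
  fix t assume t: "0 \<le> t" "t \<le> ?r"
  have "t powr \<gamma> \<le> ?r powr \<gamma>" using t assms by (intro powr_mono2) auto
  also have "\<dots> = e / (L + 1)" using assms by (simp add: powr_powr)
  finally have "L * t powr \<gamma> \<le> L * (e / (L + 1))" using assms by (intro mult_left_mono) auto
  also have "\<dots> \<le> e" using assms by (simp add: field_simps)
  finally show "L * t powr \<gamma> \<le> e" .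
qed

context ahlfors_space
begin

text \<open>Balls have positive measure, so the complement of a null set is dense.\<close>

lemma exists_near_off_null_set:
  assumes "x \<in> space M" "0 < r" "E \<in> null_sets M"
  shows "\<exists>y\<in>space M - E. d x y < r"
proof -
  have "emeasure M (qball (space M) d x r - E) \<noteq> 0"
    using qball_pos[OF assms(1,2)] qball_sets[OF assms(1,2)] assms(3) by (simp add: emeasure_Diff_null_set)
  then have "qball (space M) d x r - E \<noteq> {}" by (metis emeasure_empty)
  then show ?thesis by (auto simp: qball_def)
qed

text \<open>A continuous function inherits estimates from a dense set. Continuity is a Hoelder bound with
  its own exponent and constant, and may thus be weaker than the estimate that it transports; the factor
  \<open>(K\<^sup>2) powr \<gamma>\<close> appears because a quasi-metric need not be continuous. With \<open>L = 0\<close> this also gives the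
  uniqueness of continuous representatives.\<close>

lemma Hoelder_bounds_off_null_set:
  assumes E: "E \<in> null_sets M" and "0 \<le> L\<^sub>0" "0 < \<gamma>\<^sub>0" "0 \<le> L" "0 < \<gamma>"
    and cont: "\<And>x y. x \<in> space M \<Longrightarrow> y \<in> space M \<Longrightarrow> \<bar>v x - v y\<bar> \<le> L\<^sub>0 * d x y powr \<gamma>\<^sub>0"
    and bound: "\<And>x. x \<in> space M - E \<Longrightarrow> \<bar>v x\<bar> \<le> L"
    and osc: "\<And>x y. x \<in> space M - E \<Longrightarrow> y \<in> space M - E \<Longrightarrow> \<bar>v x - v y\<bar> \<le> L * d x y powr \<gamma>"
  shows "x \<in> space M \<Longrightarrow> \<bar>v x\<bar> \<le> L"
    and "x \<in> space M \<Longrightarrow> y \<in> space M \<Longrightarrow> \<bar>v x - v y\<bar> \<le> L * (K\<^sup>2) powr \<gamma> * d x y powr \<gamma>"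
proof -
  have near: "\<exists>x'\<in>space M - E. d x x' < r \<and> \<bar>v x - v x'\<bar> \<le> e"
    if x: "x \<in> space M" and "0 < r" "0 < e" for x r e
  proof -
    obtain r' where r': "0 < r'" "\<And>t. 0 \<le> t \<Longrightarrow> t \<le> r' \<Longrightarrow> L\<^sub>0 * t powr \<gamma>\<^sub>0 \<le> e"
      using exists_small_radius[OF \<open>0 \<le> L\<^sub>0\<close> \<open>0 < \<gamma>\<^sub>0\<close> \<open>0 < e\<close>] by metis
    obtain x' where x': "x' \<in> space M - E" "d x x' < min r r'"
      using exists_near_off_null_set[OF x _ E, of "min r r'"] r' \<open>0 < r\<close> by auto
    have "L\<^sub>0 * d x x' powr \<gamma>\<^sub>0 \<le> e" using x x' nonneg by (intro r') auto
    then show ?thesis using cont[of x x'] x x' by (intro bexI[of _ x']) auto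
  qed
  show "\<bar>v x\<bar> \<le> L" if x: "x \<in> space M"
  proof (rule field_le_epsilon)
    fix e :: real assume "0 < e"
    then obtain x' where "x' \<in> space M - E" "\<bar>v x - v x'\<bar> \<le> e" using near[OF x, of 1 e] by auto
    then show "\<bar>v x\<bar> \<le> L + e" using bound[of x'] by linarith
  qed
  show "\<bar>v x - v y\<bar> \<le> L * (K\<^sup>2) powr \<gamma> * d x y powr \<gamma>" if xy: "x \<in> space M" "y \<in> space M"
  proof (cases "x = y")
    case False
    then have dp: "0 < d x y" using dist_pos xy by blast
    show ?thesis
    proof (rule field_le_epsilon)
      fix e :: real assume e: "0 < e"
      obtain x' where x': "x' \<in> space M - E" "d x x' < d x y" "\<bar>v x - v x'\<bar> \<le> e / 2"
        using near[OF xy(1) dp, of "e / 2"] e by auto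
      obtain y' where y': "y' \<in> space M - E" "d y y' < d x y" "\<bar>v y - v y'\<bar> \<le> e / 2"
        using near[OF xy(2) dp, of "e / 2"] e by auto
      have "d x' y' \<le> K\<^sup>2 * d x y" using x' y' xy by (intro dist_perturb_le[of x y]) auto
      then have "d x' y' powr \<gamma> \<le> (K\<^sup>2 * d x y) powr \<gamma>"
        using x' y' nonneg \<open>0 < \<gamma>\<close> by (intro powr_mono2) auto
      then have "L * d x' y' powr \<gamma> \<le> L * (K\<^sup>2) powr \<gamma> * d x y powr \<gamma>"
        using \<open>0 \<le> L\<close> by (simp add: powr_mult mult.assoc mult_left_mono)
      then show "\<bar>v x - v y\<bar> \<le> L * (K\<^sup>2) powr \<gamma> * d x y powr \<gamma> + e"
        using osc[OF x'(1) y'(1)] x'(3) y'(3) by linarith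
    qed
  qed (use \<open>0 \<le> L\<close> in simp)
qed

text \<open>The extension is the limit along points of the complement of \<open>E\<close> that approach \<open>x\<close>; these
  are taken constant when \<open>x\<close> itself is not in \<open>E\<close>. An explicit formula of McShane type would
  rely on the triangle inequality, which a quasi-metric lacks.\<close>

lemma Hoelder_extension:
  assumes E: "E \<in> null_sets M" and "0 \<le> L" "0 < \<gamma>"
    and bound: "\<And>x. x \<in> space M - E \<Longrightarrow> \<bar>u x\<bar> \<le> L"
    and osc: "\<And>x y. x \<in> space M - E \<Longrightarrow> y \<in> space M - E \<Longrightarrow> \<bar>u x - u y\<bar> \<le> L * d x y powr \<gamma>"
  obtains v where "\<forall>x\<in>space M - E. v x = u x" "\<forall>x\<in>space M. \<bar>v x\<bar> \<le> L"
    "\<forall>x\<in>space M. \<forall>y\<in>space M. \<bar>v x - v y\<bar> \<le> L * (K\<^sup>2) powr \<gamma> * d x y powr \<gamma>"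
proof -
  have "\<exists>f. \<forall>n. f n \<in> space M - E \<and> d x (f n) < inverse (real (Suc n)) \<and> (x \<notin> E \<longrightarrow> f n = x)"
    if x: "x \<in> space M" for x
  proof (cases "x \<in> E")
    case True
    have "\<exists>y. y \<in> space M - E \<and> d x y < inverse (real (Suc n)) \<and> (x \<notin> E \<longrightarrow> y = x)" for n
      using exists_near_off_null_set[OF x _ E, of "inverse (real (Suc n))"] True by auto
    then show ?thesis by (intro choice allI)
  next
    case False
    then show ?thesis using x eq_zero_iff[of x x] by (intro exI[of _ "\<lambda>n. x"]) auto
  qed
  then obtain f where f: "\<And>x n. x \<in> space M \<Longrightarrow> f x n \<in> space M - E"
    "\<And>x n. x \<in> space M \<Longrightarrow> d x (f x n) < inverse (real (Suc n))"
    "\<And>x n. x \<in> space M \<Longrightarrow> x \<notin> E \<Longrightarrow> f x n = x"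
    by metis
  have "convergent (\<lambda>n. u (f x n))" if x: "x \<in> space M" for x
  proof (rule Cauchy_convergent, rule CauchyI)
    fix e :: real assume "0 < e"
    then obtain r where r: "0 < r" "\<And>t. 0 \<le> t \<Longrightarrow> t \<le> r \<Longrightarrow> L * t powr \<gamma> \<le> e / 2"
      using exists_small_radius[OF \<open>0 \<le> L\<close> \<open>0 < \<gamma>\<close>, of "e / 2"] by (metis half_gt_zero)
    obtain k where k: "inverse (real (Suc k)) < r / K\<^sup>2"
      using reals_Archimedean[of "r / K\<^sup>2"] r K_pos by auto
    have "norm (u (f x m) - u (f x n)) < e" if "k \<le> m" "k \<le> n" for m n
    proof -
      have "d x (f x j) \<le> r / K\<^sup>2" if "k \<le> j" for j
      proof -
        have "inverse (real (Suc j)) \<le> inverse (real (Suc k))" using that by (intro le_imp_inverse_le) auto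
        then show ?thesis using f(2)[OF x, of j] k by linarith
      qed
      then have "d (f x m) (f x n) \<le> K\<^sup>2 * (r / K\<^sup>2)"
        using that f(1)[OF x] x by (intro dist_le_from_center[of _ _ x]) auto
      then have "L * d (f x m) (f x n) powr \<gamma> \<le> e / 2"
        using f(1)[OF x] nonneg K_pos by (intro r) auto
      then show ?thesis using osc[OF f(1)[OF x] f(1)[OF x], of m n] \<open>0 < e\<close> by simp
    qed
    then show "\<exists>k. \<forall>m\<ge>k. \<forall>n\<ge>k. norm (u (f x m) - u (f x n)) < e" by blast
  qed
  then have lim: "(\<lambda>n. u (f x n)) \<longlonglongrightarrow> lim (\<lambda>n. u (f x n))" if "x \<in> space M" for x
    using that by (simp add: convergent_LIMSEQ_iff)
  define v where "v x = lim (\<lambda>n. u (f x n))" for x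
  have "\<forall>x\<in>space M - E. v x = u x" using f(3) by (simp add: v_def)
  moreover have "\<bar>v x\<bar> \<le> L" if x: "x \<in> space M" for x
    unfolding v_def using bound f(1)[OF x]
    by (intro LIMSEQ_le_const2[OF tendsto_rabs[OF lim[OF x]]]) blast
  moreover have "\<bar>v x - v y\<bar> \<le> L * (K\<^sup>2) powr \<gamma> * d x y powr \<gamma>" if xy: "x \<in> space M" "y \<in> space M" for x y
  proof (cases "x = y")
    case False
    then obtain k where k: "inverse (real (Suc k)) < d x y"
      using reals_Archimedean dist_pos[OF xy] by blast
    have "\<bar>u (f x n) - u (f y n)\<bar> \<le> L * (K\<^sup>2) powr \<gamma> * d x y powr \<gamma>" if "k \<le> n" for n
    proof -
      have "inverse (real (Suc n)) \<le> inverse (real (Suc k))" using that by (intro le_imp_inverse_le) auto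
      then have "d x (f x n) \<le> d x y" "d y (f y n) \<le> d x y"
        using f(2)[OF xy(1), of n] f(2)[OF xy(2), of n] k by linarith+
      then have "d (f x n) (f y n) \<le> K\<^sup>2 * d x y"
        using f(1) xy by (intro dist_perturb_le[of x y]) auto
      then have "d (f x n) (f y n) powr \<gamma> \<le> (K\<^sup>2 * d x y) powr \<gamma>"
        using f(1) xy nonneg \<open>0 < \<gamma>\<close> by (intro powr_mono2) auto
      then have "L * d (f x n) (f y n) powr \<gamma> \<le> L * (K\<^sup>2) powr \<gamma> * d x y powr \<gamma>"
        using \<open>0 \<le> L\<close> by (simp add: powr_mult mult.assoc mult_left_mono)
      then show ?thesis using osc[OF f(1)[OF xy(1)] f(1)[OF xy(2)], of n n] by linarith
    qed
    then show ?thesis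
      unfolding v_def by (intro LIMSEQ_le_const2[OF tendsto_rabs[OF tendsto_diff[OF lim[OF xy(1)] lim[OF xy(2)]]]]) blast
  qed (use \<open>0 \<le> L\<close> in simp)
  ultimately show ?thesis using that by blast
qed

lemma Hoelder_norm_le:
  assumes "0 \<le> a" "0 \<le> c" "\<And>x. x \<in> space M \<Longrightarrow> \<bar>f x\<bar> \<le> a"
    and "\<And>x y. x \<in> space M \<Longrightarrow> y \<in> space M \<Longrightarrow> \<bar>f x - f y\<bar> \<le> c * d x y powr \<gamma>"
  shows "Hoelder_norm (space M) d \<gamma> f \<le> ennreal (a + c)"
proof -
  have "\<bar>f x - f y\<bar> / d x y powr \<gamma> \<le> c" if "x \<in> space M" "y \<in> space M" "x \<noteq> y" for x y
    using assms(4)[OF that(1,2)] dist_pos[OF that] by (simp add: divide_le_eq)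
  then have "Hoelder_norm (space M) d \<gamma> f \<le> ennreal a + ennreal c"
    unfolding Hoelder_norm_def using assms by (intro add_mono SUP_least) (auto intro: ennreal_leI)
  then show ?thesis using assms by (simp add: ennreal_plus)
qed

lemma Hoelder_space_bound:
  assumes "f \<in> Hoelder_space (space M) d \<gamma>"
  shows "\<exists>c\<ge>0. \<forall>x\<in>space M. \<forall>y\<in>space M. \<bar>f x - f y\<bar> \<le> c * d x y powr \<gamma>"
proof (intro exI[of _ "enn2real (Hoelder_norm (space M) d \<gamma> f)"] conjI ballI)
  fix x y assume xy: "x \<in> space M" "y \<in> space M"
  show "\<bar>f x - f y\<bar> \<le> enn2real (Hoelder_norm (space M) d \<gamma> f) * d x y powr \<gamma>"
  proof (cases "x = y")
    case False
    let ?I = "{(x, y). x \<in> space M \<and> y \<in> space M \<and> x \<noteq> y}"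
    have "ennreal (\<bar>f x - f y\<bar> / d x y powr \<gamma>) \<le>
        (SUP (x, y)\<in>?I. ennreal (\<bar>f x - f y\<bar> / d x y powr \<gamma>))"
      using xy False by (intro SUP_upper2[of "(x, y)"]) auto
    also have "\<dots> \<le> Hoelder_norm (space M) d \<gamma> f" by (simp add: Hoelder_norm_def)
    finally have "\<bar>f x - f y\<bar> / d x y powr \<gamma> \<le> enn2real (Hoelder_norm (space M) d \<gamma> f)"
      using assms enn2real_mono[of "ennreal (\<bar>f x - f y\<bar> / d x y powr \<gamma>)"]
      by (fastforce simp: Hoelder_space_def)
    then show ?thesis using dist_pos[OF xy False] by (simp add: divide_le_eq)
  qed simp
qed simp

lemma Hoelder_ball_subset_Hoelder_space:
  assumes "0 < \<gamma>" "\<gamma> < \<gamma>'" "0 \<le> L" "\<And>x. x \<in> space M \<Longrightarrow> \<bar>v x\<bar> \<le> L"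
    and osc: "\<And>x y. x \<in> space M \<Longrightarrow> y \<in> space M \<Longrightarrow> \<bar>v x - v y\<bar> \<le> L * d x y powr \<gamma>'"
  shows "v \<in> Hoelder_space (space M) d \<gamma>"
proof -
  obtain D where D: "0 < D" "\<And>x y. x \<in> space M \<Longrightarrow> y \<in> space M \<Longrightarrow> d x y \<le> D"
    using bounded_space by metis
  have "\<bar>v x - v y\<bar> \<le> L * D powr (\<gamma>' - \<gamma>) * d x y powr \<gamma>" if xy: "x \<in> space M" "y \<in> space M" for x y
  proof -
    have "d x y powr \<gamma>' = d x y powr (\<gamma>' - \<gamma>) * d x y powr \<gamma>" by (simp flip: powr_add)
    also have "\<dots> \<le> D powr (\<gamma>' - \<gamma>) * d x y powr \<gamma>"
      using D(2)[OF xy] nonneg[OF xy] assms(2) by (intro mult_right_mono powr_mono2) auto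
    finally have "L * d x y powr \<gamma>' \<le> L * (D powr (\<gamma>' - \<gamma>) * d x y powr \<gamma>)"
      using assms(3) by (intro mult_left_mono)
    then show ?thesis using osc[OF xy] by (simp add: mult.assoc)
  qed
  then have "Hoelder_norm (space M) d \<gamma> v \<le> ennreal (L + L * D powr (\<gamma>' - \<gamma>))"
    using assms(3,4) by (intro Hoelder_norm_le) auto
  then have "Hoelder_norm (space M) d \<gamma> v < \<infinity>" by (simp add: le_less_trans[OF _ ennreal_less_top])
  moreover have "bounded (v ` space M)" using assms(4) by (auto simp: bounded_iff)
  ultimately show ?thesis by (simp add: Hoelder_space_def)
qed

text \<open>Equal codes make two functions uniformly close. For the Hoelder seminorm of their difference, pairs
  at distance at most \<open>\<delta>\<close> are handled by the stronger exponent \<open>\<gamma>'\<close>, which leaves the small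
  factor \<open>\<delta> powr (\<gamma>' - \<gamma>)\<close>, and the other pairs by uniform closeness, since their distance is bounded below.\<close>

lemma Hoelder_ball_totally_bounded:
  assumes \<gamma>: "0 < \<gamma>" "\<gamma> < \<gamma>'" and L: "0 \<le> L"
    and bound: "\<And>v x. v \<in> B \<Longrightarrow> x \<in> space M \<Longrightarrow> \<bar>v x\<bar> \<le> L"
    and osc: "\<And>v x y. v \<in> B \<Longrightarrow> x \<in> space M \<Longrightarrow> y \<in> space M \<Longrightarrow> \<bar>v x - v y\<bar> \<le> L * d x y powr \<gamma>'"
  shows "qnorm_totally_bounded (Hoelder_norm (space M) d \<gamma>) B"
proof (rule qnorm_totally_bounded_by_finite_codes)
  fix e :: real assume e: "0 < e"
  obtain \<delta> where \<delta>: "0 < \<delta>" "\<And>t. 0 \<le> t \<Longrightarrow> t \<le> \<delta> \<Longrightarrow> (2 * L) * t powr (\<gamma>' - \<gamma>) \<le> e / 2"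
    using exists_small_radius[of "2 * L" "\<gamma>' - \<gamma>" "e / 2"] L \<gamma> e by auto
  define \<eta> where "\<eta> = min (e / 4) (e * \<delta> powr \<gamma> / 4)"
  have \<eta>: "0 < \<eta>" using e \<delta> by (simp add: \<eta>_def)
  obtain \<rho> where \<rho>: "0 < \<rho>" "\<And>t. 0 \<le> t \<Longrightarrow> t \<le> \<rho> \<Longrightarrow> L * t powr \<gamma>' \<le> \<eta> / 3"
    using exists_small_radius[of L \<gamma>' "\<eta> / 3"] L \<gamma> \<eta> by auto
  obtain F where F: "finite F" "F \<subseteq> space M" "\<And>x. x \<in> space M \<Longrightarrow> \<exists>y\<in>F. d y x < \<rho>"
    using finite_net[OF \<rho>(1)] by blast
  define \<Phi> where "\<Phi> v = restrict (\<lambda>i. \<lfloor>v i / (\<eta> / 3)\<rfloor>) F" for v :: "'a \<Rightarrow> real"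
  have "finite (\<Phi> ` B)"
    unfolding \<Phi>_def using F \<eta> bound by (intro finite_rounded_values[where L = L]) auto
  moreover have "Hoelder_norm (space M) d \<gamma> (\<lambda>x. v x - w x) < ennreal e"
    if vw: "v \<in> B" "w \<in> B" "\<Phi> v = \<Phi> w" for v w
  proof -
    have small: "\<bar>v x - w x\<bar> \<le> \<eta>" if x: "x \<in> space M" for x
    proof -
      obtain i where i: "i \<in> F" "d i x < \<rho>" using F(3)[OF x] by blast
      then have s: "i \<in> space M" using F by blast
      have "\<lfloor>v i / (\<eta> / 3)\<rfloor> = \<lfloor>w i / (\<eta> / 3)\<rfloor>"
        using fun_cong[OF vw(3), of i] i by (simp add: \<Phi>_def)
      then have "\<bar>v i - w i\<bar> \<le> \<eta> / 3" using \<eta> by (intro rounded_values_eqD) auto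
      moreover have "L * d i x powr \<gamma>' \<le> \<eta> / 3" using i nonneg[OF s x] by (intro \<rho>) auto
      ultimately show ?thesis using osc[OF vw(1) s x] osc[OF vw(2) s x] by linarith
    qed
    have "\<bar>(v x - w x) - (v y - w y)\<bar> \<le> e / 2 * d x y powr \<gamma>"
      if xy: "x \<in> space M" "y \<in> space M" for x y
    proof (cases "d x y \<le> \<delta>")
      case True
      have "\<bar>(v x - w x) - (v y - w y)\<bar> \<le> 2 * L * d x y powr \<gamma>'"
        using osc[OF vw(1) xy] osc[OF vw(2) xy] by linarith
      also have "\<dots> = 2 * L * d x y powr (\<gamma>' - \<gamma>) * d x y powr \<gamma>" by (simp flip: powr_add)
      also have "\<dots> \<le> e / 2 * d x y powr \<gamma>"
        using \<delta>(2)[of "d x y"] True nonneg[OF xy] by (intro mult_right_mono) auto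
      finally show ?thesis .
    next
      case False
      have "\<bar>(v x - w x) - (v y - w y)\<bar> \<le> 2 * \<eta>" using small[OF xy(1)] small[OF xy(2)] by linarith
      also have "\<dots> \<le> e / 2 * \<delta> powr \<gamma>" by (simp add: \<eta>_def)
      also have "\<dots> \<le> e / 2 * d x y powr \<gamma>"
        using False \<delta>(1) \<gamma> e by (intro mult_left_mono powr_mono2) auto
      finally show ?thesis .
    qed
    then have "Hoelder_norm (space M) d \<gamma> (\<lambda>x. v x - w x) \<le> ennreal (\<eta> + e / 2)"
      using small \<eta> e by (intro Hoelder_norm_le) auto
    also have "\<dots> < ennreal e"
    proof (rule ennreal_lessI)
      have "\<eta> \<le> e / 4" by (simp add: \<eta>_def)
      then show "\<eta> + e / 2 < e" using e by linarith
    qed (rule e)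
    finally show ?thesis .
  qed
  ultimately show "\<exists>\<Phi> :: ('a \<Rightarrow> real) \<Rightarrow> 'a \<Rightarrow> int. finite (\<Phi> ` B) \<and>
      (\<forall>v\<in>B. \<forall>w\<in>B. \<Phi> v = \<Phi> w \<longrightarrow> Hoelder_norm (space M) d \<gamma> (\<lambda>x. v x - w x) < ennreal e)"
    by (intro exI[of _ \<Phi>]) blast
qed

lemma Hoelder_norm_diff_AE_eq:
  assumes "0 < \<gamma>" "v \<in> Hoelder_space (space M) d \<gamma>" "w \<in> Hoelder_space (space M) d \<gamma>"
    and "AE x in M. v x = w x"
  shows "Hoelder_norm (space M) d \<gamma> (\<lambda>x. v x - w x) = 0"
proof -
  obtain a where a: "0 \<le> a" "\<And>x y. x \<in> space M \<Longrightarrow> y \<in> space M \<Longrightarrow> \<bar>v x - v y\<bar> \<le> a * d x y powr \<gamma>"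
    using Hoelder_space_bound[OF assms(2)] by auto
  obtain c where c: "0 \<le> c" "\<And>x y. x \<in> space M \<Longrightarrow> y \<in> space M \<Longrightarrow> \<bar>w x - w y\<bar> \<le> c * d x y powr \<gamma>"
    using Hoelder_space_bound[OF assms(3)] by auto
  obtain N where N: "N \<in> null_sets M" "\<And>x. x \<in> space M - N \<Longrightarrow> v x = w x"
    using assms(4) by (auto elim!: AE_E3)
  have osc: "\<bar>(v x - w x) - (v y - w y)\<bar> \<le> (a + c) * d x y powr \<gamma>"
    if "x \<in> space M" "y \<in> space M" for x y
    using a(2)[OF that] c(2)[OF that] unfolding distrib_right by linarith
  have zero: "\<bar>v x - w x\<bar> \<le> 0" if "x \<in> space M" for x
  proof (rule Hoelder_bounds_off_null_set(1)[OF N(1) _ assms(1) _ assms(1) osc])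
    show "0 \<le> a + c" using a(1) c(1) by simp
    show "\<bar>v y - w y\<bar> \<le> 0" if "y \<in> space M - N" for y using N(2)[OF that] by simp
    show "\<bar>(v y - w y) - (v z - w z)\<bar> \<le> 0 * d y z powr \<gamma>"
      if "y \<in> space M - N" "z \<in> space M - N" for y z
      using N(2)[OF that(1)] N(2)[OF that(2)] by simp
  qed (use that in auto)
  then have "Hoelder_norm (space M) d \<gamma> (\<lambda>x. v x - w x) \<le> ennreal (0 + 0)"
    by (intro Hoelder_norm_le) auto
  then show ?thesis by simp
qed

lemma compact_embedding_Hoelder:
  assumes pos: "0 < p" "0 < \<beta>" and super: "s < \<beta> * p" and \<gamma>: "0 < \<gamma>" "\<gamma> < \<beta> - s / p"
    and S: "\<And>u. u \<in> S \<Longrightarrow> NS u < \<infinity>"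
      "\<And>c. c < \<infinity> \<Longrightarrow> \<exists>C>0. \<forall>u\<in>S. NS u \<le> c \<longrightarrow> u \<in> hajlasz_class M d \<beta> p C"
  shows "compact_embedding M S NS (Hoelder_space (space M) d \<gamma>) (Hoelder_norm (space M) d \<gamma>)"
  unfolding compact_embedding_def
proof (intro conjI allI impI)
  define \<gamma>' where "\<gamma>' = \<beta> - s / p"
  have \<gamma>': "\<gamma> < \<gamma>'" "0 < \<gamma>'" using \<gamma> by (auto simp: \<gamma>'_def)
  have "1 powr \<gamma>' \<le> (K\<^sup>2) powr \<gamma>'" using \<gamma>' K_ge_1 by (intro powr_mono2) auto
  then have K: "1 \<le> (K\<^sup>2) powr \<gamma>'" by simp
  show "natural_map_well_defined M S (Hoelder_space (space M) d \<gamma>) (Hoelder_norm (space M) d \<gamma>)"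
    unfolding natural_map_well_defined_def
  proof
    fix u assume u: "u \<in> S"
    obtain C where C: "0 < C" "u \<in> hajlasz_class M d \<beta> p C" using S(2)[OF S(1)[OF u]] u by blast
    obtain L E where L: "0 \<le> L" "E \<in> null_sets M" "\<And>x. x \<in> space M - E \<Longrightarrow> \<bar>u x\<bar> \<le> L"
      "\<And>x y. x \<in> space M - E \<Longrightarrow> y \<in> space M - E \<Longrightarrow> \<bar>u x - u y\<bar> \<le> L * d x y powr \<gamma>'"
      using hajlasz_class_Hoelder[OF pos C(1) super] C(2) unfolding \<gamma>'_def by metis
    obtain v where v: "\<forall>x\<in>space M - E. v x = u x" "\<forall>x\<in>space M. \<bar>v x\<bar> \<le> L"
      "\<forall>x\<in>space M. \<forall>y\<in>space M. \<bar>v x - v y\<bar> \<le> L * (K\<^sup>2) powr \<gamma>' * d x y powr \<gamma>'"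
      using Hoelder_extension[OF L(2,1) \<gamma>'(2) L(3,4)] by blast
    have "L \<le> L * (K\<^sup>2) powr \<gamma>'" using L(1) K by (simp add: mult_le_cancel_left1)
    then have vH: "v \<in> Hoelder_space (space M) d \<gamma>"
    proof (intro Hoelder_ball_subset_Hoelder_space[OF \<gamma>(1) \<gamma>'(1), of "L * (K\<^sup>2) powr \<gamma>'"])
      show "\<bar>v x\<bar> \<le> L * (K\<^sup>2) powr \<gamma>'" if "x \<in> space M" for x
        using v(2) that \<open>L \<le> L * (K\<^sup>2) powr \<gamma>'\<close> order_trans by blast
    qed (use v(3) L(1) in auto)
    have uv: "AE x in M. u x = v x" using v(1) by (intro AE_I'[OF L(2)]) force
    have "Hoelder_norm (space M) d \<gamma> (\<lambda>x. v x - w x) = 0"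
      if "w \<in> Hoelder_space (space M) d \<gamma>" "AE x in M. u x = w x" for w
    proof (rule Hoelder_norm_diff_AE_eq[OF \<gamma>(1) vH that(1)])
      show "AE x in M. v x = w x" using uv that(2) by eventually_elim simp
    qed
    then show "\<exists>v\<in>Hoelder_space (space M) d \<gamma>. (AE x in M. u x = v x) \<and>
        (\<forall>w\<in>Hoelder_space (space M) d \<gamma>. (AE x in M. u x = w x) \<longrightarrow>
           Hoelder_norm (space M) d \<gamma> (\<lambda>x. v x - w x) = 0)"
      using vH uv by blast
  qed
  fix A assume A: "A \<subseteq> S" "qnorm_bounded NS A"
  then obtain c where c: "c < \<infinity>" "\<And>u. u \<in> A \<Longrightarrow> NS u \<le> c" by (auto simp: qnorm_bounded_def)
  then obtain C where C: "0 < C" "\<And>u. u \<in> A \<Longrightarrow> u \<in> hajlasz_class M d \<beta> p C"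
    using S(2)[OF c(1)] A(1) by blast
  obtain L where L: "0 \<le> L" "\<And>u. u \<in> hajlasz_class M d \<beta> p C \<Longrightarrow> \<exists>E\<in>null_sets M.
       (\<forall>x\<in>space M - E. \<bar>u x\<bar> \<le> L) \<and>
       (\<forall>x\<in>space M - E. \<forall>y\<in>space M - E. \<bar>u x - u y\<bar> \<le> L * d x y powr \<gamma>')"
    using hajlasz_class_Hoelder[OF pos C(1) super] unfolding \<gamma>'_def by metis
  have le: "L \<le> L * (K\<^sup>2) powr \<gamma>'" using L(1) K by (simp add: mult_le_cancel_left1)
  have img: "(\<forall>x\<in>space M. \<bar>v x\<bar> \<le> L * (K\<^sup>2) powr \<gamma>') \<and>
      (\<forall>x\<in>space M. \<forall>y\<in>space M. \<bar>v x - v y\<bar> \<le> L * (K\<^sup>2) powr \<gamma>' * d x y powr \<gamma>')"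
    if v: "v \<in> natural_image M (Hoelder_space (space M) d \<gamma>) A" for v
  proof -
    have vH: "v \<in> Hoelder_space (space M) d \<gamma>" and "v \<in> hajlasz_class M d \<beta> p C"
      using v by (auto simp: natural_image_def intro: hajlasz_class_cong_AE[OF C(2)])
    then obtain E where E: "E \<in> null_sets M" "\<And>x. x \<in> space M - E \<Longrightarrow> \<bar>v x\<bar> \<le> L"
      "\<And>x y. x \<in> space M - E \<Longrightarrow> y \<in> space M - E \<Longrightarrow> \<bar>v x - v y\<bar> \<le> L * d x y powr \<gamma>'"
      using L(2) by metis
    obtain c where c: "0 \<le> c" "\<And>x y. x \<in> space M \<Longrightarrow> y \<in> space M \<Longrightarrow> \<bar>v x - v y\<bar> \<le> c * d x y powr \<gamma>"
      using Hoelder_space_bound[OF vH] by auto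
    note everywhere = Hoelder_bounds_off_null_set[OF E(1) c(1) \<gamma>(1) L(1) \<gamma>'(2) c(2) E(2,3)]
    show ?thesis using everywhere(1)[THEN order_trans[OF _ le]] everywhere(2) by blast
  qed
  show "qnorm_totally_bounded (Hoelder_norm (space M) d \<gamma>) (natural_image M (Hoelder_space (space M) d \<gamma>) A)"
    by (rule Hoelder_ball_totally_bounded[OF \<gamma>(1) \<gamma>'(1), of "L * (K\<^sup>2) powr \<gamma>'"]) (use img L(1) in auto)
qed

end

section \<open>The compact embeddings\<close>

text \<open>The second condition makes sense also for \<open>a p \<ge> s\<close>, where every \<open>p' > 0\<close> satisfies it. Stated in this
  form, the Lebesgue embeddings of both ranges of the theorem are one result.\<close>

lemma less_Sobolev_exponent_iff:
  fixes s p p' a :: real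
  assumes "0 < p" "0 < p'" "a * p < s"
  shows "p' < s * p / (s - a * p) \<longleftrightarrow> s / p - s / p' < a"
proof -
  have "s / p - s / p' < a \<longleftrightarrow> (s / p - s / p') * (p * p') < a * (p * p')"
    using assms by (intro mult_less_cancel_right_pos[symmetric]) simp
  also have "(s / p - s / p') * (p * p') = s * p' - s * p"
    using assms by (simp add: left_diff_distrib)
  finally have "s / p - s / p' < a \<longleftrightarrow> p' * (s - a * p) < s * p"
    by (simp add: algebra_simps)
  then show ?thesis using assms by (simp add: less_divide_eq)
qed

lemma ahlfors_space_exists:
  assumes "quasi_metric_measure_space M d" "emeasure M (space M) < \<infinity>" "0 < s"
    and "locally_lower_Ahlfors_regular M d s"
  shows "\<exists>b K. ahlfors_space M d s b K"
proof -
  interpret quasi_metric_measure_space M d by fact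
  obtain b where b: "0 < b" "\<And>x r. x \<in> space M \<Longrightarrow> 0 < r \<Longrightarrow> r \<le> 1 \<Longrightarrow>
      ennreal (b * r powr s) \<le> emeasure M (qball (space M) d x r)"
    using assms(4) unfolding locally_lower_Ahlfors_regular_def by metis
  obtain C\<^sub>0 where C0: "\<And>x y. x \<in> space M \<Longrightarrow> y \<in> space M \<Longrightarrow> d y x \<le> C\<^sub>0 * d x y"
    using quasi_symmetric by metis
  obtain C\<^sub>1 where C1: "\<And>x y z. x \<in> space M \<Longrightarrow> y \<in> space M \<Longrightarrow> z \<in> space M \<Longrightarrow>
      d x y \<le> C\<^sub>1 * max (d x z) (d z y)"
    using quasi_triangle by metis
  define K where "K = max 1 (max C\<^sub>0 C\<^sub>1)"
  have K: "1 \<le> K" "C\<^sub>0 \<le> K" "C\<^sub>1 \<le> K" by (auto simp: K_def)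
  have "ahlfors_space M d s b K"
  proof (unfold_locales)
    fix x y assume xy: "x \<in> space M" "y \<in> space M"
    show "d y x \<le> K * d x y"
      using C0[OF xy] mult_right_mono[OF K(2) nonneg[OF xy]] by linarith
    fix z assume z: "z \<in> space M"
    have "0 \<le> max (d x z) (d z y)" using nonneg xy z by (simp add: le_max_iff_disj)
    then show "d x y \<le> K * max (d x z) (d z y)"
      using C1[OF xy z] mult_right_mono[OF K(3)] by (meson order_trans)
  qed (use assms b K in auto)
  then show ?thesis by blast
qed

context ahlfors_space
begin

text \<open>The smoothness \<open>\<beta>\<close> has to be below \<open>\<alpha>\<close>, below \<open>s / p\<close>, and above \<open>s / p - s / p'\<close>, so that its
  Sobolev exponent exceeds \<open>p'\<close>.\<close>

lemma compact_embeddings_Lp: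
  assumes pos: "0 < \<alpha>" "0 < p" "0 < q" and p': "0 < p'" "s / p - s / p' < \<alpha>"
  shows "compact_embedding M (HTL_space M d \<alpha> p q) (HTL_qnorm M d \<alpha> p q)
           (Lp_fun_space M p') (Lp_fun_qnorm M p')"
    and "compact_embedding M (HB_space M d \<alpha> p q) (HB_qnorm M d \<alpha> p q)
           (Lp_fun_space M p') (Lp_fun_qnorm M p')"
proof -
  have "max 0 (s / p - s / p') < min \<alpha> (s / p)" using pos p' s_pos by simp
  then obtain \<beta> where "max 0 (s / p - s / p') < \<beta>" "\<beta> < min \<alpha> (s / p)"
    using dense by blast
  then have \<beta>: "0 < \<beta>" "s / p - s / p' < \<beta>" "\<beta> < \<alpha>" "\<beta> < s / p" by simp_all
  have sub: "\<beta> * p < s" using \<beta>(4) pos by (simp add: field_simps)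
  have p'': "p' < s * p / (s - \<beta> * p)"
    using \<beta>(2) less_Sobolev_exponent_iff[OF pos(2) p'(1) sub] by blast
  show "compact_embedding M (HTL_space M d \<alpha> p q) (HTL_qnorm M d \<alpha> p q)
           (Lp_fun_space M p') (Lp_fun_qnorm M p')"
    by (rule compact_embedding_Lp[OF pos(2) \<beta>(1) sub p'(1) p''])
      (use HTL_ball_subset_hajlasz_class[OF pos(2) \<beta>(3) pos(3)] in
        \<open>auto simp: HTL_space_def Lp_fun_space_def\<close>)
  show "compact_embedding M (HB_space M d \<alpha> p q) (HB_qnorm M d \<alpha> p q)
           (Lp_fun_space M p') (Lp_fun_qnorm M p')"
    by (rule compact_embedding_Lp[OF pos(2) \<beta>(1) sub p'(1) p''])
      (use HB_ball_subset_hajlasz_class[OF pos(2) \<beta>(3) pos(3)] in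
        \<open>auto simp: HB_space_def Lp_fun_space_def\<close>)
qed

lemma compact_embeddings_Hoelder:
  assumes pos: "0 < \<alpha>" "0 < p" "0 < q" and \<gamma>: "0 < \<gamma>" "\<gamma> < \<alpha> - s / p"
  shows "compact_embedding M (HTL_space M d \<alpha> p q) (HTL_qnorm M d \<alpha> p q)
           (Hoelder_space (space M) d \<gamma>) (Hoelder_norm (space M) d \<gamma>)"
    and "compact_embedding M (HB_space M d \<alpha> p q) (HB_qnorm M d \<alpha> p q)
           (Hoelder_space (space M) d \<gamma>) (Hoelder_norm (space M) d \<gamma>)"
proof -
  obtain \<beta> where \<beta>: "\<gamma> + s / p < \<beta>" "\<beta> < \<alpha>" using dense[of "\<gamma> + s / p" \<alpha>] \<gamma> by auto
  have "0 < s / p" using s_pos pos by simp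
  then have \<beta>': "0 < \<beta>" "s / p < \<beta>" "\<gamma> < \<beta> - s / p" using \<beta> \<gamma> by linarith+
  have super: "s < \<beta> * p" using \<beta>'(2) pos by (simp add: divide_less_eq)
  show "compact_embedding M (HTL_space M d \<alpha> p q) (HTL_qnorm M d \<alpha> p q)
           (Hoelder_space (space M) d \<gamma>) (Hoelder_norm (space M) d \<gamma>)"
    by (rule compact_embedding_Hoelder[OF pos(2) \<beta>'(1) super \<gamma>(1) \<beta>'(3)])
      (use HTL_ball_subset_hajlasz_class[OF pos(2) \<beta>(2) pos(3)] in \<open>auto simp: HTL_space_def\<close>)
  show "compact_embedding M (HB_space M d \<alpha> p q) (HB_qnorm M d \<alpha> p q)
           (Hoelder_space (space M) d \<gamma>) (Hoelder_norm (space M) d \<gamma>)"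
    by (rule compact_embedding_Hoelder[OF pos(2) \<beta>'(1) super \<gamma>(1) \<beta>'(3)])
      (use HB_ball_subset_hajlasz_class[OF pos(2) \<beta>(2) pos(3)] in \<open>auto simp: HB_space_def\<close>)
qed

end

theorem theorem6p19:
  fixes M :: "'a measure" and d :: "'a \<Rightarrow> 'a \<Rightarrow> real"
    and s \<alpha> p :: real and q :: ennreal
  assumes "quasi_metric_measure_space M d"
    and "emeasure M (space M) < \<infinity>"
    and "0 < s" and "locally_lower_Ahlfors_regular M d s"
    and "0 < \<alpha>" and "0 < p" and "0 < q"
  shows
    "(\<alpha> * p < s \<longrightarrow>
        (\<forall>p'. 0 < p' \<and> p' < s * p / (s - \<alpha> * p) \<longrightarrow>
          compact_embedding M (HTL_space M d \<alpha> p q) (HTL_qnorm M d \<alpha> p q)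
            (Lp_fun_space M p') (Lp_fun_qnorm M p') \<and>
          compact_embedding M (HB_space M d \<alpha> p q) (HB_qnorm M d \<alpha> p q)
            (Lp_fun_space M p') (Lp_fun_qnorm M p'))) \<and>
     (s < \<alpha> * p \<longrightarrow>
        (\<forall>\<gamma>. 0 < \<gamma> \<and> \<gamma> < \<alpha> - s / p \<longrightarrow>
          compact_embedding M (HTL_space M d \<alpha> p q) (HTL_qnorm M d \<alpha> p q)
            (Hoelder_space (space M) d \<gamma>) (Hoelder_norm (space M) d \<gamma>) \<and>
          compact_embedding M (HB_space M d \<alpha> p q) (HB_qnorm M d \<alpha> p q)
            (Hoelder_space (space M) d \<gamma>) (Hoelder_norm (space M) d \<gamma>)) \<and>
        (\<forall>p'. 0 < p' \<longrightarrow>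
          compact_embedding M (HTL_space M d \<alpha> p q) (HTL_qnorm M d \<alpha> p q)
            (Lp_fun_space M p') (Lp_fun_qnorm M p') \<and>
          compact_embedding M (HB_space M d \<alpha> p q) (HB_qnorm M d \<alpha> p q)
            (Lp_fun_space M p') (Lp_fun_qnorm M p')))"
proof -
  obtain b K where "ahlfors_space M d s b K" using ahlfors_space_exists[OF assms(1-4)] by blast
  then interpret ahlfors_space M d s b K .
  note Lp = compact_embeddings_Lp[OF assms(5-7)] and Hoelder = compact_embeddings_Hoelder[OF assms(5-7)]
  have sub: "s / p - s / p' < \<alpha>" if "\<alpha> * p < s" "0 < p'" "p' < s * p / (s - \<alpha> * p)" for p'
    using that less_Sobolev_exponent_iff[OF \<open>0 < p\<close>] by blast
  have super: "s / p - s / p' < \<alpha>" if "s < \<alpha> * p" "0 < p'" for p'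
  proof -
    have "s / p < \<alpha>" using that \<open>0 < p\<close> by (simp add: divide_less_eq)
    moreover have "0 < s / p'" using that s_pos by simp
    ultimately show ?thesis by linarith
  qed
  show ?thesis using Lp sub super Hoelder by blast
qed

end
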